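(* Let $q\in\mathbb{C}$ be a root of unity with $q^4\neq 1$. For every $n\ge 2$, let $\phi: C_n(q,q)\to A_n$ be the algebra homomorphism with $\phi(g_i)=G_i$ for $1\le i\le n-1$, let $\mathrm{tr}$ be the Markov-type trace on $C_\infty(q,q)$, and let $\mathrm{Tr}_n=\frac{1}{2^n}\mathrm{Trace}$ be the normalized matrix trace on $2^n\times 2^n$ matrices. Then for all $A,B\in A_n$ and $\chi\in\{E_n,G_n\}\subset A_{n+1}$, $$\mathrm{Tr}_{n+1}\big((A\otimes I)\,\chi\,(B\otimes I)\big)=\mathrm{Tr}_{n+1}(\chi)\,\mathrm{Tr}_n(AB),$$ and consequently the traces correspond: $\mathrm{tr}(a)=\mathrm{Tr}_n(\phi(a))$ for all $a\in C_n(q,q)$.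
   Context: $I$ is the $2\times2$ identity matrix. $B_n$ is the braid group with standard generators $\sigma_1,\dots,\sigma_{n-1}$. The BMW algebra $C_n(r,q)$ is the complex unital algebra with invertible generators $g_1,\dots,g_{n-1}$ satisfying the braid relations ($g_ig_j=g_jg_i$ for $|i-j|\ge2$, $g_ig_{i+1}g_i=g_{i+1}g_ig_{i+1}$) and (R1) $e_ig_i=r^{-1}e_i$, (R2) $e_ig_{i-1}^{\pm1}e_i=r^{\pm1}e_i$, where $e_i=1-\frac{g_i-g_i^{-1}}{q-q^{-1}}$. Here $r=q$. $C_\infty(r,q)$ is the inductive limit of the $C_n(r,q)$ under $g_i\mapsto g_i$. By a known theorem of Wenzl, with $x=1+\frac{r-r^{-1}}{q-q^{-1}}$ (so $x=2$ when $r=q$), there is a unique linear functional $\mathrm{tr}$ on $C_\infty(r,q)$ such that $\mathrm{tr}(1)=1$; $\mathrm{tr}(ab)=\mathrm{tr}(ba)$; $\mathrm{tr}(e_i)=\frac1x$; $\mathrm{tr}(g_i^{\pm1})=\frac{r^{\pm1}}{x}$; and $\mathrm{tr}(a\chi b)=\mathrm{tr}(\chi)\mathrm{tr}(ab)$ for $a,b\in C_{n-1}(r,q)$ and $\chi=g_{n-1}$ or $e_{n-1}$. Let $R=\begin{pmatrix} q&0&0&0\\0&0&q^{-1}&0\\0&q^{-1}&0&0\\0&0&0&q\end{pmatrix}$, which satisfies the Yang-Baxter equation $(R\otimes I)(I\otimes R)(R\otimes I)=(I\otimes R)(R\otimes I)(I\otimes R)$. Let $\pi_n(\sigma_i)=I^{\otimes(i-1)}\otimes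 R\otimes I^{\otimes(n-i-1)}$ be the resulting representation of $B_n$ and put $G_i=\pi_n(\sigma_i)$ and $E_i=1-\frac{G_i-G_i^{-1}}{q-q^{-1}}$. $A_n$ is the subalgebra of $2^n\times2^n$ complex matrices spanned by $\pi_n(B_n)$, embedded in $A_{n+1}$ by $X\mapsto X\otimes I$; in particular $G_n=I^{\otimes(n-1)}\otimes R\in A_{n+1}$ and $E_n\in A_{n+1}$ is defined correspondingly. The assignment $g_i\mapsto G_i$ is known to define an algebra homomorphism $\phi:C_n(q,q)\to A_n$. *)

theory Defs
  imports
    Jordan_Normal_Form.VS_Connect
    "HOL-Library.Poly_Mapping"
    "HOL-Algebra.QuotRing"
begin

text \<open>
  Complex algebras are \<^typ>\<open>(complex, 'a) module\<close> records of HOL-Algebra, whose fields hold both the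
  ring operations and the scalar multiplication.  The scalars are the type \<^typ>\<open>complex\<close> itself.
\<close>

type_synonym 'a complex_algebra = "(complex, 'a) module"

definition algebra_hom ::
  "'a complex_algebra \<Rightarrow> 'b complex_algebra \<Rightarrow> ('a \<Rightarrow> 'b) \<Rightarrow> bool" where
  "algebra_hom A B f \<longleftrightarrow> f \<in> Ring.ring_hom A B \<and>
     (\<forall>c. \<forall>a\<in>carrier A. f (c \<odot>\<^bsub>A\<^esub> a) = c \<odot>\<^bsub>B\<^esub> f a)"

definition linear_functional :: "'a complex_algebra \<Rightarrow> ('a \<Rightarrow> complex) \<Rightarrow> bool" where
  "linear_functional A t \<longleftrightarrow>
     (\<forall>a\<in>carrier A. \<forall>b\<in>carrier A. t (a \<oplus>\<^bsub>A\<^esub> b) = t a + t b) \<and>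
     (\<forall>c. \<forall>a\<in>carrier A. t (c \<odot>\<^bsub>A\<^esub> a) = c * t a)"

definition quotient_algebra :: "'a complex_algebra \<Rightarrow> 'a set \<Rightarrow> 'a set complex_algebra" where
  "quotient_algebra A I =
     \<lparr>carrier = carrier (A Quot I), mult = mult (A Quot I), one = one (A Quot I),
      zero = zero (A Quot I), add = add (A Quot I),
      smult = (\<lambda>c X. \<Union>a\<in>X. I +>\<^bsub>A\<^esub> (c \<odot>\<^bsub>A\<^esub> a))\<rparr>"


section \<open>Inductive limits of sequences of algebras\<close>

text \<open>
  Here \<^term>\<open>f n m\<close> is the transition map from \<^term>\<open>A n\<close> to \<^term>\<open>A m\<close> for \<^term>\<open>n \<le> m\<close>.  Elements of
  the limit are classes of pairs \<open>(n, a)\<close> with \<open>a\<close> in \<^term>\<open>A n\<close>, two pairs being identified if they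
  become equal in some later \<^term>\<open>A k\<close>.
\<close>

definition lim_class ::
  "(nat \<Rightarrow> 'a complex_algebra) \<Rightarrow> (nat \<Rightarrow> nat \<Rightarrow> 'a \<Rightarrow> 'a) \<Rightarrow> nat \<Rightarrow> 'a \<Rightarrow> (nat \<times> 'a) set" where
  "lim_class A f n a =
     {(m, b). b \<in> carrier (A m) \<and> (\<exists>k. n \<le> k \<and> m \<le> k \<and> f n k a = f m k b)}"

definition lim_algebra ::
  "(nat \<Rightarrow> 'a complex_algebra) \<Rightarrow> (nat \<Rightarrow> nat \<Rightarrow> 'a \<Rightarrow> 'a) \<Rightarrow> (nat \<times> 'a) set complex_algebra" where
  "lim_algebra A f =
     \<lparr>carrier = {lim_class A f n a | n a. a \<in> carrier (A n)},
      mult = (\<lambda>X Y. \<Union>(n, a)\<in>X. \<Union>(m, b)\<in>Y. let k = max n m in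
                lim_class A f k (f n k a \<otimes>\<^bsub>A k\<^esub> f m k b)),
      one = lim_class A f 0 \<one>\<^bsub>A 0\<^esub>,
      zero = lim_class A f 0 \<zero>\<^bsub>A 0\<^esub>,
      add = (\<lambda>X Y. \<Union>(n, a)\<in>X. \<Union>(m, b)\<in>Y. let k = max n m in
                lim_class A f k (f n k a \<oplus>\<^bsub>A k\<^esub> f m k b)),
      smult = (\<lambda>c X. \<Union>(n, a)\<in>X. lim_class A f n (c \<odot>\<^bsub>A n\<^esub> a))\<rparr>"


section \<open>Words in generators and their inverses; free algebras\<close>

datatype letter = Pos nat | Neg nat

definition letters :: "nat \<Rightarrow> letter set" where
  "letters n = Pos ` {1..<n} \<union> Neg ` {1..<n}"

text \<open>
  With words forming a monoid under concatenation, \<^typ>\<open>letter list \<Rightarrow>\<^sub>0 complex\<close> is the free unital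
  complex algebra on the letters: the product on \<^typ>\<open>'a \<Rightarrow>\<^sub>0 'b\<close> is convolution.
\<close>

instantiation list :: (type) monoid_add
begin
definition zero_list :: "'a list" where "zero_list = []"
definition plus_list :: "'a list \<Rightarrow> 'a list \<Rightarrow> 'a list" where "plus_list u v = u @ v"
instance by standard (simp_all add: zero_list_def plus_list_def)
end

type_synonym free_elem = "letter list \<Rightarrow>\<^sub>0 complex"

definition free_algebra :: "nat \<Rightarrow> free_elem complex_algebra" where
  "free_algebra n =
     \<lparr>carrier = {a. \<forall>w \<in> Poly_Mapping.keys a. set w \<subseteq> letters n}, mult = (*), one = 1, zero = 0,
      add = (+), smult = (\<lambda>c a. Poly_Mapping.single [] c * a)\<rparr>"


section \<open>The BMW algebras\<close>

definition gen :: "nat \<Rightarrow> free_elem" where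
  "gen i = Poly_Mapping.single [Pos i] 1"

definition gen_inv :: "nat \<Rightarrow> free_elem" where
  "gen_inv i = Poly_Mapping.single [Neg i] 1"

definition scalar :: "complex \<Rightarrow> free_elem" where
  "scalar c = Poly_Mapping.single [] c"

definition gen_e :: "complex \<Rightarrow> nat \<Rightarrow> free_elem" where
  "gen_e q i = 1 - scalar (1 / (q - inverse q)) * (gen i - gen_inv i)"

definition bmw_relators :: "nat \<Rightarrow> complex \<Rightarrow> complex \<Rightarrow> free_elem set" where
  "bmw_relators n r q =
     {gen i * gen_inv i - 1 | i. 1 \<le> i \<and> i < n} \<union>
     {gen_inv i * gen i - 1 | i. 1 \<le> i \<and> i < n} \<union>
     {gen i * gen j - gen j * gen i | i j. 1 \<le> i \<and> i + 2 \<le> j \<and> j < n} \<union>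
     {gen i * gen (i+1) * gen i - gen (i+1) * gen i * gen (i+1) | i. 1 \<le> i \<and> i + 1 < n} \<union>
     {gen_e q i * gen i - scalar (inverse r) * gen_e q i | i. 1 \<le> i \<and> i < n} \<union>
     {gen_e q i * gen (i-1) * gen_e q i - scalar r * gen_e q i | i. 2 \<le> i \<and> i < n} \<union>
     {gen_e q i * gen_inv (i-1) * gen_e q i - scalar (inverse r) * gen_e q i | i. 2 \<le> i \<and> i < n}"

definition bmw_ideal :: "nat \<Rightarrow> complex \<Rightarrow> complex \<Rightarrow> free_elem set" where
  "bmw_ideal n r q = Idl\<^bsub>free_algebra n\<^esub> (bmw_relators n r q)"

definition bmw :: "complex \<Rightarrow> complex \<Rightarrow> nat \<Rightarrow> free_elem set complex_algebra" where
  "bmw r q n = quotient_algebra (free_algebra n) (bmw_ideal n r q)"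

definition bmw_elem :: "complex \<Rightarrow> complex \<Rightarrow> nat \<Rightarrow> free_elem \<Rightarrow> free_elem set" where
  "bmw_elem r q n a = bmw_ideal n r q +>\<^bsub>free_algebra n\<^esub> a"

text \<open>The transition maps \<open>g\<^sub>i \<mapsto> g\<^sub>i\<close>: the coset of \<open>a\<close> is sent to the coset of the same \<open>a\<close>.\<close>

definition bmw_map ::
  "complex \<Rightarrow> complex \<Rightarrow> nat \<Rightarrow> nat \<Rightarrow> free_elem set \<Rightarrow> free_elem set" where
  "bmw_map r q n m X = (\<Union>a\<in>X. bmw_elem r q m a)"

type_synonym bmw_lim_elem = "(nat \<times> free_elem set) set"

definition bmw_lim :: "complex \<Rightarrow> complex \<Rightarrow> bmw_lim_elem complex_algebra" where
  "bmw_lim r q = lim_algebra (bmw r q) (bmw_map r q)"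

definition bmw_incl :: "complex \<Rightarrow> complex \<Rightarrow> nat \<Rightarrow> free_elem set \<Rightarrow> bmw_lim_elem" where
  "bmw_incl r q n = lim_class (bmw r q) (bmw_map r q) n"

definition lim_g :: "complex \<Rightarrow> complex \<Rightarrow> nat \<Rightarrow> bmw_lim_elem" where
  "lim_g r q i = bmw_incl r q (i+1) (bmw_elem r q (i+1) (gen i))"

definition lim_g_inv :: "complex \<Rightarrow> complex \<Rightarrow> nat \<Rightarrow> bmw_lim_elem" where
  "lim_g_inv r q i = bmw_incl r q (i+1) (bmw_elem r q (i+1) (gen_inv i))"

definition lim_e :: "complex \<Rightarrow> complex \<Rightarrow> nat \<Rightarrow> bmw_lim_elem" where
  "lim_e r q i = bmw_incl r q (i+1) (bmw_elem r q (i+1) (gen_e q i))"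

text \<open>The properties that characterize Wenzl's trace.\<close>

definition is_bmw_trace :: "complex \<Rightarrow> complex \<Rightarrow> (bmw_lim_elem \<Rightarrow> complex) \<Rightarrow> bool" where
  "is_bmw_trace r q tr \<longleftrightarrow>
     (let C = bmw_lim r q; x = 1 + (r - inverse r) / (q - inverse q) in
       linear_functional C tr \<and>
       tr \<one>\<^bsub>C\<^esub> = 1 \<and>
       (\<forall>a\<in>carrier C. \<forall>b\<in>carrier C. tr (a \<otimes>\<^bsub>C\<^esub> b) = tr (b \<otimes>\<^bsub>C\<^esub> a)) \<and>
       (\<forall>i\<ge>1. tr (lim_e r q i) = 1 / x \<and> tr (lim_g r q i) = r / x \<and>
               tr (lim_g_inv r q i) = inverse r / x) \<and>
       (\<forall>n\<ge>2. \<forall>a \<in> bmw_incl r q (n-1) ` carrier (bmw r q (n-1)).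
               \<forall>b \<in> bmw_incl r q (n-1) ` carrier (bmw r q (n-1)).
               \<forall>\<chi> \<in> {lim_g r q (n-1), lim_e r q (n-1)}.
          tr (a \<otimes>\<^bsub>C\<^esub> \<chi> \<otimes>\<^bsub>C\<^esub> b) = tr \<chi> * tr (a \<otimes>\<^bsub>C\<^esub> b)))"


section \<open>Braid groups\<close>

inductive braid_equiv :: "nat \<Rightarrow> letter list \<Rightarrow> letter list \<Rightarrow> bool" for n where
  refl: "braid_equiv n u u"
| sym: "braid_equiv n u v \<Longrightarrow> braid_equiv n v u"
| trans: "braid_equiv n u v \<Longrightarrow> braid_equiv n v w \<Longrightarrow> braid_equiv n u w"
| cong: "braid_equiv n u v \<Longrightarrow> braid_equiv n (x @ u @ y) (x @ v @ y)"
| right_inv: "1 \<le> i \<Longrightarrow> i < n \<Longrightarrow> braid_equiv n [Pos i, Neg i] []"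
| left_inv: "1 \<le> i \<Longrightarrow> i < n \<Longrightarrow> braid_equiv n [Neg i, Pos i] []"
| far: "1 \<le> i \<Longrightarrow> i + 2 \<le> j \<Longrightarrow> j < n \<Longrightarrow> braid_equiv n [Pos i, Pos j] [Pos j, Pos i]"
| braid: "1 \<le> i \<Longrightarrow> i + 1 < n \<Longrightarrow>
    braid_equiv n [Pos i, Pos (i+1), Pos i] [Pos (i+1), Pos i, Pos (i+1)]"

definition braid_class :: "nat \<Rightarrow> letter list \<Rightarrow> letter list set" where
  "braid_class n u = {v. set v \<subseteq> letters n \<and> braid_equiv n u v}"

definition braid_group :: "nat \<Rightarrow> letter list set monoid" where
  "braid_group n =
     \<lparr>carrier = {braid_class n u | u. set u \<subseteq> letters n},
      mult = (\<lambda>X Y. \<Union>u\<in>X. \<Union>v\<in>Y. braid_class n (u @ v)),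
      one = braid_class n []\<rparr>"


section \<open>The matrix representation\<close>

definition kronecker :: "complex mat \<Rightarrow> complex mat \<Rightarrow> complex mat" (infixr \<open>\<otimes>\<^sub>K\<close> 72) where
  "A \<otimes>\<^sub>K B = mat (dim_row A * dim_row B) (dim_col A * dim_col B)
     (\<lambda>(i, j). A $$ (i div dim_row B, j div dim_col B) * B $$ (i mod dim_row B, j mod dim_col B))"

definition normalized_trace :: "nat \<Rightarrow> complex mat \<Rightarrow> complex" where
  "normalized_trace n M = (1 / 2 ^ n) * (\<Sum>i<2 ^ n. M $$ (i, i))"

definition R_mat :: "complex \<Rightarrow> complex mat" where
  "R_mat q = mat_of_rows_list 4
     [[q, 0, 0, 0],
      [0, 0, inverse q, 0],
      [0, inverse q, 0, 0],
      [0, 0, 0, q]]"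

abbreviation Mat_alg :: "nat \<Rightarrow> complex mat complex_algebra" where
  "Mat_alg n \<equiv> module_mat TYPE(complex) (2 ^ n) (2 ^ n)"

definition G_mat :: "nat \<Rightarrow> complex \<Rightarrow> nat \<Rightarrow> complex mat" where
  "G_mat n q i = 1\<^sub>m (2 ^ (i-1)) \<otimes>\<^sub>K R_mat q \<otimes>\<^sub>K 1\<^sub>m (2 ^ (n-i-1))"

definition E_mat :: "nat \<Rightarrow> complex \<Rightarrow> nat \<Rightarrow> complex mat" where
  "E_mat n q i =
     1\<^sub>m (2 ^ n) - (1 / (q - inverse q)) \<cdot>\<^sub>m (G_mat n q i - inv\<^bsub>Mat_alg n\<^esub> (G_mat n q i))"

fun letter_mat :: "nat \<Rightarrow> complex \<Rightarrow> letter \<Rightarrow> complex mat" where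
  "letter_mat n q (Pos i) = G_mat n q i"
| "letter_mat n q (Neg i) = inv\<^bsub>Mat_alg n\<^esub> (G_mat n q i)"

definition word_mat :: "nat \<Rightarrow> complex \<Rightarrow> letter list \<Rightarrow> complex mat" where
  "word_mat n q w = foldr (\<lambda>l M. letter_mat n q l * M) w (1\<^sub>m (2 ^ n))"

text \<open>
  The matrix of a braid is computed from any word representing it; it does not depend on the word
  because \<open>R\<close> is invertible (for \<open>q \<noteq> 0\<close>) and satisfies the Yang-Baxter equation.
\<close>

definition braid_rep :: "nat \<Rightarrow> complex \<Rightarrow> letter list set \<Rightarrow> complex mat" where
  "braid_rep n q X = word_mat n q (SOME w. w \<in> X)"

definition A_alg :: "nat \<Rightarrow> complex \<Rightarrow> complex mat complex_algebra" where
  "A_alg n q = (Mat_alg n)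
     \<lparr>carrier := LinearCombinations.module.span class_ring (Mat_alg n)
                   (braid_rep n q ` carrier (braid_group n))\<rparr>"

end

theory Submission
  imports Defs
begin

text \<open>
  Both sides are functionals on the free algebra that vanish on the relators, send \<open>1\<close> to \<open>1\<close> and
  satisfy \<open>T (a g\<^sub>m\<^sup>\<plusminus>\<^sup>1 b) = q\<^sup>\<plusminus>\<^sup>1/2 T (a b)\<close> for \<open>a\<close>, \<open>b\<close> in the first \<open>m - 1\<close> generators: on the matrix side
  because the partial trace of \<open>R\<^sup>\<plusminus>\<^sup>1\<close> over its second tensor factor is \<open>q\<^sup>\<plusminus>\<^sup>1 I\<close>, on the other side by the
  axioms of the trace.  These properties determine the functional, because modulo the relators the
  algebra \<open>C\<^sub>m\<^sub>+\<^sub>1\<close> is spanned by the elements \<open>a b\<close> and \<open>a g\<^sub>m\<^sup>\<plusminus>\<^sup>1 b\<close> with \<open>a\<close>, \<open>b\<close> in \<open>C\<^sub>m\<close>.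
\<close>

section \<open>Free algebras and the BMW ideals\<close>

text \<open>The spanning statement hinges on one rewriting problem: a product g_m^(+-1)
  g_(m-1)^(+-1) g_m^(+-1) must be brought to forms with at most one letter of index m. Braid
  relations settle six of the eight sign patterns, (R2) supplies the other two, and (R1), read as a
  cubic relation for g_m, handles squares. Taking g_m and its inverse as middle factors, in place of
  g_m and e_m, loses nothing: e_m is a combination of 1, g_m and g_m^-1. Congruences are taken
  modulo the ideal of one fixed \<open>n\<close>, even for elements in fewer generators, because the
  homomorphism is given at level \<open>n\<close> only. On the matrix side R(q)^-1 = R(q^-1), so one
  partial trace computation serves both signs. On the other side x = 2, and the factor of an inverse
  generator comes out as q/2 - (q - q^-1)/2 = q^-1/2.\<close>

lemma free_algebra_simps:
  "mult (free_algebra n) = (*)" "one (free_algebra n) = 1" "zero (free_algebra n) = 0"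
  "add (free_algebra n) = (+)" "smult (free_algebra n) c a = scalar c * a"
  by (simp_all add: free_algebra_def scalar_def)

abbreviation free_carrier :: "nat \<Rightarrow> free_elem set" where
  "free_carrier n \<equiv> carrier (free_algebra n)"

lemma free_carrier_iff: "a \<in> free_carrier n \<longleftrightarrow> (\<forall>w \<in> Poly_Mapping.keys a. set w \<subseteq> letters n)"
  by (simp add: free_algebra_def)

lemma free_carrier_single: "set w \<subseteq> letters n \<Longrightarrow> Poly_Mapping.single w c \<in> free_carrier n"
  by (auto simp: free_carrier_iff)

lemma free_carrier_scalar [simp]: "scalar c \<in> free_carrier n"
  by (simp add: scalar_def free_carrier_single)

lemma scalar_0 [simp]: "scalar 0 = 0"
  by (simp add: scalar_def)

lemma scalar_1 [simp]: "scalar 1 = 1"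
  using single_one[where 'a = "letter list"] by (simp add: scalar_def zero_list_def)

lemma scalar_add: "scalar (c + d) = scalar c + scalar d"
  by (simp add: scalar_def single_add)

lemma scalar_uminus: "scalar (- c) = - scalar c"
  by (simp add: scalar_def single_uminus)

lemma scalar_mult: "scalar (c * d) = scalar c * scalar d"
  by (simp add: scalar_def mult_single plus_list_def)

lemma sum_monomials: "(\<Sum>w\<in>Poly_Mapping.keys a. Poly_Mapping.single w (Poly_Mapping.lookup a w)) = a"
  by (rule poly_mapping_eqI)
    (simp add: lookup_sum lookup_single when_def sum.delta in_keys_iff)

lemma scalar_commute: "scalar c * a = a * scalar c"
proof -
  have "scalar c * Poly_Mapping.single w d = Poly_Mapping.single w d * scalar c" for w d
    by (simp add: scalar_def mult_single plus_list_def mult.commute)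
  then have "scalar c * (\<Sum>w\<in>Poly_Mapping.keys a. Poly_Mapping.single w (Poly_Mapping.lookup a w)) =
     (\<Sum>w\<in>Poly_Mapping.keys a. Poly_Mapping.single w (Poly_Mapping.lookup a w)) * scalar c"
    by (simp only: sum_distrib_left sum_distrib_right)
  then show ?thesis by (simp only: sum_monomials)
qed

lemma free_carrier_1 [simp]: "1 \<in> free_carrier n"
  using free_carrier_scalar[of 1] by simp

lemma free_carrier_0 [simp]: "0 \<in> free_carrier n"
  using free_carrier_scalar[of 0] by simp

lemma free_carrier_add [intro, simp]:
  "a \<in> free_carrier n \<Longrightarrow> b \<in> free_carrier n \<Longrightarrow> a + b \<in> free_carrier n"
  using keys_add[of a b] by (auto simp: free_carrier_iff)

lemma free_carrier_mult [intro, simp]: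
  "a \<in> free_carrier n \<Longrightarrow> b \<in> free_carrier n \<Longrightarrow> a * b \<in> free_carrier n"
  using keys_mult[of a b] by (fastforce simp: free_carrier_iff plus_list_def)

lemma free_carrier_uminus [intro, simp]: "a \<in> free_carrier n \<Longrightarrow> - a \<in> free_carrier n"
  using free_carrier_mult[OF free_carrier_scalar[of "-1"], of a] by (simp add: scalar_uminus)

lemma free_carrier_diff [intro, simp]:
  "a \<in> free_carrier n \<Longrightarrow> b \<in> free_carrier n \<Longrightarrow> a - b \<in> free_carrier n"
  using free_carrier_add[of a n "- b"] by simp

lemma letters_mono: "m \<le> n \<Longrightarrow> letters m \<subseteq> letters n"
  by (auto simp: letters_def)

lemma free_carrier_mono: "m \<le> n \<Longrightarrow> a \<in> free_carrier m \<Longrightarrow> a \<in> free_carrier n"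
  using letters_mono[of m n] by (fastforce simp: free_carrier_iff)

lemma free_carrier_gen [simp]:
  "1 \<le> i \<Longrightarrow> i < n \<Longrightarrow> gen i \<in> free_carrier n" "1 \<le> i \<Longrightarrow> i < n \<Longrightarrow> gen_inv i \<in> free_carrier n"
  by (simp_all add: gen_def gen_inv_def free_carrier_single letters_def)

lemma free_carrier_gen_e [simp]: "1 \<le> i \<Longrightarrow> i < n \<Longrightarrow> gen_e q i \<in> free_carrier n"
  by (simp add: gen_e_def)

text \<open>Monomials grow by one letter at the right end and are then summed. Later inductions
  therefore only have to absorb a single generator multiplied from the right.\<close>

lemma free_carrier_induct [consumes 1, case_names scalar add gen gen_inv]:
  assumes "a \<in> free_carrier n"
    and scalar: "\<And>c. P (scalar c)"
    and add: "\<And>a b. a \<in> free_carrier n \<Longrightarrow> b \<in> free_carrier n \<Longrightarrow> P a \<Longrightarrow> P b \<Longrightarrow> P (a + b)"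
    and gen: "\<And>a i. a \<in> free_carrier n \<Longrightarrow> P a \<Longrightarrow> 1 \<le> i \<Longrightarrow> i < n \<Longrightarrow> P (a * gen i)"
    and gen_inv: "\<And>a i. a \<in> free_carrier n \<Longrightarrow> P a \<Longrightarrow> 1 \<le> i \<Longrightarrow> i < n \<Longrightarrow> P (a * gen_inv i)"
  shows "P a"
proof -
  have mono: "P (Poly_Mapping.single w c)" if "set w \<subseteq> letters n" for w c
    using that
  proof (induction w rule: rev_induct)
    case Nil
    then show ?case using scalar[of c] by (simp add: scalar_def)
  next
    case (snoc l w)
    then have F: "Poly_Mapping.single w c \<in> free_carrier n" and P: "P (Poly_Mapping.single w c)"
      by (auto intro: free_carrier_single)
    from snoc.prems consider i where "l = Pos i" "1 \<le> i" "i < n" | i where "l = Neg i" "1 \<le> i" "i < n"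
      by (auto simp: letters_def)
    then show ?case
      using gen[OF F P] gen_inv[OF F P]
      by cases (simp_all add: gen_def gen_inv_def mult_single plus_list_def)
  qed
  \<comment> \<open>Membership of the partial sums is carried along because the \<open>add\<close>
    premise asks for it.\<close>
  have "P (\<Sum>w\<in>S. Poly_Mapping.single w (Poly_Mapping.lookup a w)) \<and>
      (\<Sum>w\<in>S. Poly_Mapping.single w (Poly_Mapping.lookup a w)) \<in> free_carrier n"
    if "S \<subseteq> Poly_Mapping.keys a" for S
    using finite_subset[OF that finite_keys] that
  proof (induction S rule: finite_induct)
    case empty
    then show ?case using scalar[of 0] by simp
  next
    case (insert w S)
    then have "set w \<subseteq> letters n" using assms(1) by (auto simp: free_carrier_iff)
    then show ?case using insert by (auto intro!: add mono free_carrier_single)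
  qed
  from this[of "Poly_Mapping.keys a"] show ?thesis by (simp only: sum_monomials)
qed

text \<open>Generators are indexed from 1 to n - 1, so at n = 1 there are no letters. This is the
  base case C_1 = complex numbers.\<close>

lemma free_carrier_Suc_0: "a \<in> free_carrier (Suc 0) \<Longrightarrow> \<exists>c. a = scalar c"
  by (induction rule: free_carrier_induct) (auto simp: scalar_add[symmetric])

lemma ring_free_algebra: "ring (free_algebra n)"
proof (rule ringI)
  show "abelian_group (free_algebra n)"
    by (rule abelian_groupI) (auto simp: free_algebra_simps algebra_simps intro!: bexI[of _ "- _"])
  show "monoid (free_algebra n)"
    by (rule monoidI) (auto simp: free_algebra_simps algebra_simps)
qed (auto simp: free_algebra_simps algebra_simps)

lemma a_inv_free_algebra: "a \<in> free_carrier n \<Longrightarrow> \<ominus>\<^bsub>free_algebra n\<^esub> a = - a"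
  using abelian_group.minus_equality[OF ring.is_abelian_group[OF ring_free_algebra, of n], of "- a" a]
  by (simp add: free_algebra_simps)

lemma bmw_relators_subset: "bmw_relators n r q \<subseteq> free_carrier n"
  by (auto simp: bmw_relators_def)

lemma ideal_bmw_ideal: "ideal (bmw_ideal n r q) (free_algebra n)"
  unfolding bmw_ideal_def by (rule ring.genideal_ideal[OF ring_free_algebra bmw_relators_subset])

lemma relator_in_bmw_ideal: "a \<in> bmw_relators n r q \<Longrightarrow> a \<in> bmw_ideal n r q"
  unfolding bmw_ideal_def using ring.genideal_self[OF ring_free_algebra bmw_relators_subset] by blast

lemma bmw_ideal_carrier: "a \<in> bmw_ideal n r q \<Longrightarrow> a \<in> free_carrier n"
  using ideal.Icarr[OF ideal_bmw_ideal] .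

lemma bmw_ideal_0 [simp]: "0 \<in> bmw_ideal n r q"
  using additive_subgroup.zero_closed[OF ideal.axioms(1)[OF ideal_bmw_ideal]]
  by (simp add: free_algebra_simps)

lemma bmw_ideal_add: "a \<in> bmw_ideal n r q \<Longrightarrow> b \<in> bmw_ideal n r q \<Longrightarrow> a + b \<in> bmw_ideal n r q"
  using additive_subgroup.a_closed[OF ideal.axioms(1)[OF ideal_bmw_ideal]]
  by (simp add: free_algebra_simps)

lemma bmw_ideal_mult_left: "a \<in> bmw_ideal n r q \<Longrightarrow> b \<in> free_carrier n \<Longrightarrow> b * a \<in> bmw_ideal n r q"
  using ideal.I_l_closed[OF ideal_bmw_ideal] by (simp add: free_algebra_simps)

lemma bmw_ideal_mult_right: "a \<in> bmw_ideal n r q \<Longrightarrow> b \<in> free_carrier n \<Longrightarrow> a * b \<in> bmw_ideal n r q"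
  using ideal.I_r_closed[OF ideal_bmw_ideal] by (simp add: free_algebra_simps)

lemma bmw_ideal_uminus: "a \<in> bmw_ideal n r q \<Longrightarrow> - a \<in> bmw_ideal n r q"
  using bmw_ideal_mult_left[OF _ free_carrier_scalar[of "-1"]] by (fastforce simp: scalar_uminus)

lemma bmw_ideal_diff: "a \<in> bmw_ideal n r q \<Longrightarrow> b \<in> bmw_ideal n r q \<Longrightarrow> a - b \<in> bmw_ideal n r q"
  using bmw_ideal_add[of a _ _ _ "- b"] bmw_ideal_uminus[of b] by simp

text \<open>The larger ideal, contracted to the smaller free algebra, is an ideal containing the
  relators for \<open>m\<close>, so minimality of the generated ideal applies. This makes the
  transition maps well defined.\<close>

lemma bmw_ideal_mono:
  assumes "m \<le> n"
  shows "bmw_ideal m r q \<subseteq> bmw_ideal n r q"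
proof -
  have "ideal (bmw_ideal n r q \<inter> free_carrier m) (free_algebra m)"
  proof (rule idealI[OF ring_free_algebra])
    show "subgroup (bmw_ideal n r q \<inter> free_carrier m) (add_monoid (free_algebra m))"
    proof
      fix x assume x: "x \<in> bmw_ideal n r q \<inter> free_carrier m"
      then have "inv\<^bsub>add_monoid (free_algebra m)\<^esub> x = - x"
        using a_inv_free_algebra[of x m] by (simp add: a_inv_def)
      with x show "inv\<^bsub>add_monoid (free_algebra m)\<^esub> x \<in> bmw_ideal n r q \<inter> free_carrier m"
        by (auto intro: bmw_ideal_uminus)
    qed (auto simp: free_algebra_simps intro: bmw_ideal_add)
  qed (auto simp: free_algebra_simps intro: bmw_ideal_mult_left bmw_ideal_mult_right free_carrier_mono[OF assms])
  moreover have "bmw_relators m r q \<subseteq> bmw_relators n r q"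
    using assms unfolding bmw_relators_def by (intro Un_mono Collect_mono impI) (metis order_less_le_trans)+
  then have "bmw_relators m r q \<subseteq> bmw_ideal n r q \<inter> free_carrier m"
    using relator_in_bmw_ideal bmw_relators_subset by blast
  ultimately show ?thesis
    using ring.genideal_minimal[OF ring_free_algebra] unfolding bmw_ideal_def[of m] by blast
qed

section \<open>Computing in the quotient algebra with representatives\<close>

lemma bmw_elem_iff:
  assumes "a \<in> free_carrier n"
  shows "x \<in> bmw_elem r q n a \<longleftrightarrow> x - a \<in> bmw_ideal n r q"
  unfolding bmw_elem_def a_r_coset_def' free_algebra_simps by (auto intro!: bexI[of _ "x - a"])

lemma bmw_elem_eq_iff:
  assumes "a \<in> free_carrier n" "b \<in> free_carrier n"
  shows "bmw_elem r q n a = bmw_elem r q n b \<longleftrightarrow> a - b \<in> bmw_ideal n r q"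
proof
  assume "bmw_elem r q n a = bmw_elem r q n b"
  moreover have "a \<in> bmw_elem r q n a" by (simp add: bmw_elem_iff assms)
  ultimately show "a - b \<in> bmw_ideal n r q" using assms by (simp add: bmw_elem_iff)
next
  assume *: "a - b \<in> bmw_ideal n r q"
  have "x - a \<in> bmw_ideal n r q \<longleftrightarrow> x - b \<in> bmw_ideal n r q" for x
    using bmw_ideal_add[OF _ *, of "x - a"] bmw_ideal_diff[OF _ *, of "x - b"] by auto
  then show "bmw_elem r q n a = bmw_elem r q n b" using assms by (auto simp: bmw_elem_iff)
qed

text \<open>Operations on cosets and on limit classes are defined as unions over all
  representatives; such a union collapses once its members are shown to coincide.\<close>

lemma UN_eq_const:
  assumes "a \<in> X" "\<And>x. x \<in> X \<Longrightarrow> f x = c"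
  shows "(\<Union>x\<in>X. f x) = c"
  using assms by (metis SUP_eq_const empty_iff)

lemma carrier_bmw: "carrier (bmw r q n) = bmw_elem r q n ` free_carrier n"
  by (auto simp: bmw_def quotient_algebra_def FactRing_def A_RCOSETS_def' bmw_elem_def)

lemma one_bmw: "\<one>\<^bsub>bmw r q n\<^esub> = bmw_elem r q n 1"
  by (simp add: bmw_def quotient_algebra_def FactRing_def bmw_elem_def free_algebra_simps)

lemma mult_bmw:
  assumes "a \<in> free_carrier n" "b \<in> free_carrier n"
  shows "bmw_elem r q n a \<otimes>\<^bsub>bmw r q n\<^esub> bmw_elem r q n b = bmw_elem r q n (a * b)"
  using ideal.rcoset_mult_add[OF ideal_bmw_ideal assms, of r q]
  by (simp add: bmw_def quotient_algebra_def FactRing_def bmw_elem_def free_algebra_simps)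

lemma add_bmw:
  assumes "a \<in> free_carrier n" "b \<in> free_carrier n"
  shows "bmw_elem r q n a \<oplus>\<^bsub>bmw r q n\<^esub> bmw_elem r q n b = bmw_elem r q n (a + b)"
  using abelian_subgroup.a_rcos_sum[OF abelian_subgroupI3[OF ideal.axioms(1)[OF ideal_bmw_ideal]
      ring.is_abelian_group[OF ring_free_algebra]] assms, of r q]
  by (simp add: bmw_def quotient_algebra_def FactRing_def bmw_elem_def free_algebra_simps)

lemma smult_bmw:
  assumes "a \<in> free_carrier n"
  shows "c \<odot>\<^bsub>bmw r q n\<^esub> bmw_elem r q n a = bmw_elem r q n (scalar c * a)"
proof -
  have "bmw_elem r q n (scalar c * x) = bmw_elem r q n (scalar c * a)" if "x \<in> bmw_elem r q n a" for x
  proof -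
    from that assms have *: "x - a \<in> bmw_ideal n r q" by (simp add: bmw_elem_iff)
    then have "x \<in> free_carrier n" using free_carrier_add[OF bmw_ideal_carrier[OF *] assms] by simp
    moreover have "scalar c * x - scalar c * a \<in> bmw_ideal n r q"
      using bmw_ideal_mult_left[OF * free_carrier_scalar[of c]] by (simp add: algebra_simps)
    ultimately show ?thesis using assms by (simp add: bmw_elem_eq_iff)
  qed
  moreover have "a \<in> bmw_elem r q n a" using assms by (simp add: bmw_elem_iff)
  ultimately have "(\<Union>x\<in>bmw_elem r q n a. bmw_elem r q n (scalar c * x)) = bmw_elem r q n (scalar c * a)"
    by (rule UN_eq_const[rotated])
  then show ?thesis
    by (simp add: bmw_def quotient_algebra_def free_algebra_simps bmw_elem_def)
qed

lemma bmw_map_elem: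
  assumes "n \<le> m" "a \<in> free_carrier n"
  shows "bmw_map r q n m (bmw_elem r q n a) = bmw_elem r q m a"
proof -
  have "bmw_elem r q m x = bmw_elem r q m a" if "x \<in> bmw_elem r q n a" for x
  proof -
    from that assms have *: "x - a \<in> bmw_ideal n r q" by (simp add: bmw_elem_iff)
    then have "x \<in> free_carrier n" using free_carrier_add[OF bmw_ideal_carrier[OF *] assms(2)] by simp
    then show ?thesis
      using assms * bmw_ideal_mono[OF assms(1)] free_carrier_mono[OF assms(1)]
      by (subst bmw_elem_eq_iff) auto
  qed
  moreover have "a \<in> bmw_elem r q n a" using assms by (simp add: bmw_elem_iff)
  ultimately show ?thesis unfolding bmw_map_def by (rule UN_eq_const[rotated])
qed

section \<open>Spanning sets of the BMW algebras\<close>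

text \<open>Membership of both sides is built in, so that transitivity and products need no side
  conditions.\<close>

definition bmw_cong :: "nat \<Rightarrow> complex \<Rightarrow> complex \<Rightarrow> free_elem \<Rightarrow> free_elem \<Rightarrow> bool" where
  "bmw_cong n r q a b \<longleftrightarrow> a \<in> free_carrier n \<and> b \<in> free_carrier n \<and> a - b \<in> bmw_ideal n r q"

text \<open>The preimage in the free algebra of C_m + C_m g_m C_m + C_m g_m^-1 C_m, with the ideal
  taken at level \<open>n\<close>. Scalars are absorbed into the left factor, so closure under sums
  suffices for linearity; \<open>1 \<le> m\<close> excludes the nonexistent generator of index
  0.\<close>

inductive_set bmw_span :: "nat \<Rightarrow> complex \<Rightarrow> complex \<Rightarrow> nat \<Rightarrow> free_elem set" for n r q m where
  flank: "a \<in> free_carrier m \<Longrightarrow> b \<in> free_carrier m \<Longrightarrow>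
    c = 1 \<or> 1 \<le> m \<and> c \<in> {gen m, gen_inv m} \<Longrightarrow> a * c * b \<in> bmw_span n r q m"
| add: "x \<in> bmw_span n r q m \<Longrightarrow> y \<in> bmw_span n r q m \<Longrightarrow> x + y \<in> bmw_span n r q m"
| cong: "x \<in> bmw_span n r q m \<Longrightarrow> bmw_cong n r q x y \<Longrightarrow> y \<in> bmw_span n r q m"

section \<open>Congruence modulo the BMW ideal at level n\<close>

context
  fixes n :: nat and r q :: complex
begin

abbreviation cong (infix \<open>\<approx>\<close> 50) where "a \<approx> b \<equiv> bmw_cong n r q a b"

lemma cong_refl: "a \<in> free_carrier n \<Longrightarrow> a \<approx> a"
  by (simp add: bmw_cong_def)

lemma cong_sym: "a \<approx> b \<Longrightarrow> b \<approx> a"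
  using bmw_ideal_uminus[of "a - b"] by (auto simp: bmw_cong_def)

lemma cong_trans [trans]: "a \<approx> b \<Longrightarrow> b \<approx> c \<Longrightarrow> a \<approx> c"
  using bmw_ideal_add[of "a - b" _ _ _ "b - c"] by (auto simp: bmw_cong_def)

lemma cong_mult: "a \<approx> b \<Longrightarrow> c \<approx> d \<Longrightarrow> a * c \<approx> b * d"
  using bmw_ideal_add[OF bmw_ideal_mult_right[of "a - b" _ _ _ c] bmw_ideal_mult_left[of "c - d" _ _ _ b]]
  by (auto simp: bmw_cong_def algebra_simps)

lemma cong_mult_left: "a \<in> free_carrier n \<Longrightarrow> b \<approx> c \<Longrightarrow> a * b \<approx> a * c"
  by (simp add: cong_mult cong_refl)

lemma cong_mult_right: "a \<in> free_carrier n \<Longrightarrow> b \<approx> c \<Longrightarrow> b * a \<approx> c * a"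
  by (simp add: cong_mult cong_refl)

lemma cong_relator:
  "a - b \<in> bmw_relators n r q \<Longrightarrow> a \<in> free_carrier n \<Longrightarrow> b \<in> free_carrier n \<Longrightarrow> a \<approx> b"
  by (simp add: bmw_cong_def relator_in_bmw_ideal)

lemma cong_left_inverse: "1 \<le> i \<Longrightarrow> i < n \<Longrightarrow> gen_inv i * gen i \<approx> 1"
  by (rule cong_relator) (auto simp: bmw_relators_def)

lemma cong_right_inverse: "1 \<le> i \<Longrightarrow> i < n \<Longrightarrow> gen i * gen_inv i \<approx> 1"
  by (rule cong_relator) (auto simp: bmw_relators_def)

lemma cong_braid:
  assumes "1 \<le> i" "i + 1 < n"
  shows "gen i * gen (i + 1) * gen i \<approx> gen (i + 1) * gen i * gen (i + 1)"
proof (rule cong_relator)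
  show "gen i * gen (i + 1) * gen i - gen (i + 1) * gen i * gen (i + 1) \<in> bmw_relators n r q"
    using assms unfolding bmw_relators_def by blast
qed (use assms in auto)

lemma cong_gen_e_sandwich:
  assumes "2 \<le> i" "i < n"
  shows "gen_e q i * gen (i - 1) * gen_e q i \<approx> scalar r * gen_e q i"
    and "gen_e q i * gen_inv (i - 1) * gen_e q i \<approx> scalar (inverse r) * gen_e q i"
proof -
  have "gen_e q i * gen (i - 1) * gen_e q i - scalar r * gen_e q i \<in> bmw_relators n r q"
    "gen_e q i * gen_inv (i - 1) * gen_e q i - scalar (inverse r) * gen_e q i \<in> bmw_relators n r q"
    using assms unfolding bmw_relators_def by blast+
  then show "gen_e q i * gen (i - 1) * gen_e q i \<approx> scalar r * gen_e q i"
    "gen_e q i * gen_inv (i - 1) * gen_e q i \<approx> scalar (inverse r) * gen_e q i"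
    using assms by (auto intro!: cong_relator)
qed

text \<open>From x u = v z, multiply by the inverse of x on the left and that of z on the right. The
  commutation and braid relators involve positive generators only; repeated use of this lemma
  produces all versions with inverses.\<close>

lemma cong_conjugate:
  assumes "x' * x \<approx> 1" "z * z' \<approx> 1" "x * u \<approx> v * z"
    and "x' \<in> free_carrier n" "z' \<in> free_carrier n" "u \<in> free_carrier n" "v \<in> free_carrier n"
  shows "u * z' \<approx> x' * v"
proof -
  have "u * z' \<approx> x' * (x * u) * z'"
    using cong_mult_right[OF _ cong_sym[OF assms(1)], of "u * z'"] assms by (simp add: mult.assoc)
  also have "x' * (x * u) * z' \<approx> x' * (v * z) * z'"
    using assms by (intro cong_mult_right cong_mult_left)
  also have "x' * (v * z) * z' \<approx> x' * v"
    using cong_mult_left[OF _ assms(2), of "x' * v"] assms by (simp add: mult.assoc)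
  finally show ?thesis .
qed

lemma cong_far:
  assumes "1 \<le> i" "i + 2 \<le> j" "j < n" "x \<in> {gen i, gen_inv i}" "y \<in> {gen j, gen_inv j}"
  shows "x * y \<approx> y * x"
proof -
  have i: "1 \<le> i" "i < n" and j: "1 \<le> j" "j < n" using assms by auto
  have 1: "gen i * gen j \<approx> gen j * gen i"
    using assms(1-3) i j by (intro cong_relator) (auto simp: bmw_relators_def)
  have 2: "gen_inv i * gen j \<approx> gen j * gen_inv i"
    using cong_conjugate[OF cong_left_inverse[OF i] cong_right_inverse[OF i] 1] i j cong_sym by simp
  have 3: "gen i * gen_inv j \<approx> gen_inv j * gen i"
    using cong_conjugate[OF cong_left_inverse[OF j] cong_right_inverse[OF j] cong_sym[OF 1]] i j by simp
  have 4: "gen_inv i * gen_inv j \<approx> gen_inv j * gen_inv i"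
    using cong_conjugate[OF cong_left_inverse[OF i] cong_right_inverse[OF i] 3] i j cong_sym by simp
  show ?thesis using assms(4,5) 1 2 3 4 by auto
qed

text \<open>The letters of \<open>free_carrier (j - 1)\<close> have index at most j - 2, so each of
  them is far from j.\<close>

lemma cong_far_free_carrier:
  assumes "a \<in> free_carrier (j - 1)" "j < n" "y \<in> {gen j, gen_inv j}" "2 \<le> j"
  shows "a * y \<approx> y * a"
  using assms(1)
proof (induction rule: free_carrier_induct)
  case (scalar c)
  have "y \<in> free_carrier n" using assms by auto
  then show ?case by (simp add: scalar_commute cong_refl)
next
  case (add a b)
  then show ?case
    using bmw_ideal_add[of "a * y - y * a" n r q "b * y - y * b"]
    by (simp add: bmw_cong_def algebra_simps)
next
  case (gen a i)
  then have "a * gen i * y \<approx> a * (y * gen i)"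
    using assms cong_mult_left[OF _ cong_far[of i j "gen i" y], of a] free_carrier_mono[of "j - 1" n a]
    by (simp add: mult.assoc)
  also have "a * (y * gen i) \<approx> y * (a * gen i)"
    using cong_mult_right[OF _ gen.IH, of "gen i"] gen assms by (simp add: mult.assoc)
  finally show ?case .
next
  case (gen_inv a i)
  then have "a * gen_inv i * y \<approx> a * (y * gen_inv i)"
    using assms cong_mult_left[OF _ cong_far[of i j "gen_inv i" y], of a] free_carrier_mono[of "j - 1" n a]
    by (simp add: mult.assoc)
  also have "a * (y * gen_inv i) \<approx> y * (a * gen_inv i)"
    using cong_mult_right[OF _ gen_inv.IH, of "gen_inv i"] gen_inv assms by (simp add: mult.assoc)
  finally show ?case .
qed

section \<open>Reduction to at most one letter of highest index\<close>

context
  assumes q: "q - inverse q \<noteq> 0" and r: "r \<noteq> 0"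
begin

lemma bmw_span_free_carrier:
  assumes "m < n" "x \<in> bmw_span n r q m"
  shows "x \<in> free_carrier n"
  using assms(2)
proof (induction rule: bmw_span.induct)
  case (flank a b c)
  then show ?case using assms(1) free_carrier_mono[of m n] by auto
qed (auto simp: bmw_cong_def)

lemma free_carrier_bmw_span: "a \<in> free_carrier m \<Longrightarrow> a \<in> bmw_span n r q m"
  using bmw_span.flank[of a m 1 1] by simp

lemma bmw_span_mult_left:
  assumes "m < n" "x \<in> bmw_span n r q m" "d \<in> free_carrier m"
  shows "d * x \<in> bmw_span n r q m"
  using assms(2)
proof (induction rule: bmw_span.induct)
  case (flank a b c)
  then show ?case using bmw_span.flank[of "d * a" m b c] assms(3) by (simp add: mult.assoc)
next
  case (add x y)
  then show ?case by (simp add: algebra_simps bmw_span.add)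
next
  case (cong x y)
  then show ?case
    using bmw_span.cong[OF cong.IH cong_mult_left] free_carrier_mono[of m n d] assms by simp
qed

lemma bmw_span_mult_right:
  assumes "m < n" "x \<in> bmw_span n r q m" "d \<in> free_carrier m"
  shows "x * d \<in> bmw_span n r q m"
  using assms(2)
proof (induction rule: bmw_span.induct)
  case (flank a b c)
  then show ?case using bmw_span.flank[of a m "b * d" c] assms(3) by (simp add: mult.assoc)
next
  case (add x y)
  then show ?case by (simp add: algebra_simps bmw_span.add)
next
  case (cong x y)
  then show ?case
    using bmw_span.cong[OF cong.IH cong_mult_right] free_carrier_mono[of m n d] assms by simp
qed

lemma bmw_span_uminus: "m < n \<Longrightarrow> x \<in> bmw_span n r q m \<Longrightarrow> - x \<in> bmw_span n r q m"
  using bmw_span_mult_left[of m x "scalar (-1)"] by (simp add: scalar_uminus)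

lemma bmw_span_diff:
  "m < n \<Longrightarrow> x \<in> bmw_span n r q m \<Longrightarrow> y \<in> bmw_span n r q m \<Longrightarrow> x - y \<in> bmw_span n r q m"
  using bmw_span.add[of x n r q m "- y"] bmw_span_uminus[of m y] by simp

lemma bmw_span_gen:
  assumes "1 \<le> m" "c \<in> {gen m, gen_inv m}"
  shows "c \<in> bmw_span n r q m"
  using bmw_span.flank[of 1 m 1 c] assms by simp

text \<open>With the denominator cleared, a nonzero multiple of e_m is g_m^-1 - g_m plus a scalar;
  the reductions below work with this multiple.\<close>

lemma scalar_gen_e: "scalar (q - inverse q) * gen_e q m = scalar (q - inverse q) - gen m + gen_inv m"
proof -
  have "scalar (q - inverse q) * (scalar (1 / (q - inverse q)) * x) = x" for x
    using q by (simp add: mult.assoc[symmetric] scalar_mult[symmetric])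
  then show ?thesis by (simp add: gen_e_def algebra_simps)
qed

lemma cong_gen_e_gen: "1 \<le> m \<Longrightarrow> m < n \<Longrightarrow> gen_e q m * gen m \<approx> scalar (inverse r) * gen_e q m"
  by (rule cong_relator) (auto simp: bmw_relators_def)

text \<open>The inverse form of (R1): write e as r (r^-1 e), replace r^-1 e by e g, and cancel g
  against g^-1.\<close>

lemma cong_gen_e_gen_inv:
  assumes "1 \<le> m" "m < n"
  shows "gen_e q m * gen_inv m \<approx> scalar r * gen_e q m"
proof -
  have "gen_e q m * gen_inv m \<approx> scalar r * (scalar (inverse r) * gen_e q m) * gen_inv m"
    using assms r by (simp add: cong_refl scalar_mult[symmetric] mult.assoc[symmetric])
  also have "scalar r * (scalar (inverse r) * gen_e q m) * gen_inv m \<approx>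
      scalar r * (gen_e q m * gen m) * gen_inv m"
    using assms by (intro cong_mult_left cong_mult_right cong_sym[OF cong_gen_e_gen]) auto
  also have "\<dots> \<approx> scalar r * gen_e q m"
    using assms cong_mult_left[OF _ cong_right_inverse[OF assms], of "scalar r * gen_e q m"]
    by (simp add: mult.assoc)
  finally show ?thesis .
qed

lemma scalar_gen_e_span:
  assumes "1 \<le> m" "m < n"
  shows "scalar (q - inverse q) - gen m + gen_inv m \<in> bmw_span n r q m"
  using assms by (intro bmw_span.add bmw_span_diff bmw_span_gen free_carrier_bmw_span) auto

text \<open>By (R1), E g and E g^-1 are scalar multiples of E = (q - q^-1) e modulo the relators.
  Expanding E = Z - g + g^-1 in these products leaves the square as the only term not already known
  to lie in the span.\<close>

lemma gen_square_span:
  assumes m: "1 \<le> m" "m < n"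
  shows "gen m * gen m \<in> bmw_span n r q m" "gen_inv m * gen_inv m \<in> bmw_span n r q m"
proof -
  define Z where "Z = scalar (q - inverse q)"
  define E where "E = Z - gen m + gen_inv m"
  have Z: "Z \<in> free_carrier k" for k by (simp add: Z_def)
  have E: "E \<in> bmw_span n r q m" and Ee: "E = Z * gen_e q m"
    using scalar_gen_e_span[OF m] scalar_gen_e[of m] by (auto simp: E_def Z_def)
  have "scalar (inverse r) * E \<approx> E * gen m"
    using cong_mult_left[OF Z cong_sym[OF cong_gen_e_gen[OF m]]]
    by (simp add: Ee mult.assoc[symmetric] scalar_commute[of _ Z])
  from bmw_span.cong[OF bmw_span_mult_left[OF m(2) E] this]
  have 1: "E * gen m \<in> bmw_span n r q m" by simp
  have "scalar r * E \<approx> E * gen_inv m"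
    using cong_mult_left[OF Z cong_sym[OF cong_gen_e_gen_inv[OF m]]]
    by (simp add: Ee mult.assoc[symmetric] scalar_commute[of _ Z])
  from bmw_span.cong[OF bmw_span_mult_left[OF m(2) E] this]
  have 2: "E * gen_inv m \<in> bmw_span n r q m" by simp
  have 3: "gen_inv m * gen m \<in> bmw_span n r q m" "gen m * gen_inv m \<in> bmw_span n r q m"
    using bmw_span.cong[OF free_carrier_bmw_span[of 1 m]] m
      cong_sym[OF cong_left_inverse[OF m]] cong_sym[OF cong_right_inverse[OF m]] by auto
  have 4: "Z * gen m \<in> bmw_span n r q m" "Z * gen_inv m \<in> bmw_span n r q m"
    using m Z by (auto intro!: bmw_span_mult_left intro: bmw_span_gen)
  have "gen m * gen m = Z * gen m + gen_inv m * gen m - E * gen m"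
    by (simp add: E_def algebra_simps)
  also have "\<dots> \<in> bmw_span n r q m"
    by (intro bmw_span.add bmw_span_diff m 1 3 4)
  finally show "gen m * gen m \<in> bmw_span n r q m" .
  have "gen_inv m * gen_inv m = E * gen_inv m + gen m * gen_inv m - Z * gen_inv m"
    by (simp add: E_def algebra_simps)
  also have "\<dots> \<in> bmw_span n r q m"
    by (intro bmw_span.add bmw_span_diff m 2 3 4)
  finally show "gen_inv m * gen_inv m \<in> bmw_span n r q m" .
qed

text \<open>The core reduction: outer letters of index m are traded for outer letters of index m -
  1, which \<open>bmw_span\<close> allows as flanking factors.\<close>

lemma gen_sandwich_span:
  assumes m: "2 \<le> m" "m < n"
    and c: "c \<in> {gen m, gen_inv m}" "d \<in> {gen m, gen_inv m}"
    and p: "p \<in> {gen (m - 1), gen_inv (m - 1)}"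
  shows "c * p * d \<in> bmw_span n r q m"
proof -
  define g where "g = gen m"
  define g' where "g' = gen_inv m"
  define h where "h = gen (m - 1)"
  define h' where "h' = gen_inv (m - 1)"
  have hm: "h \<in> free_carrier m" "h' \<in> free_carrier m" using m by (auto simp: h_def h'_def)
  have F: "h \<in> free_carrier n" "h' \<in> free_carrier n" "g \<in> free_carrier n" "g' \<in> free_carrier n"
    using m by (auto simp: h_def h'_def g_def g'_def)
  have gi: "g' * g \<approx> 1" "g * g' \<approx> 1" and hi: "h' * h \<approx> 1" "h * h' \<approx> 1"
    using m cong_left_inverse[of m] cong_right_inverse[of m]
      cong_left_inverse[of "m - 1"] cong_right_inverse[of "m - 1"]
    by (auto simp: g_def g'_def h_def h'_def)
  \<comment> \<open>From the braid relation 1, conjugation gives 2 and 3; conjugating 3 and 2 again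
    gives 4 and 5, and 4 yields 6. Each trades the outer letters g, g^-1 for h, h^-1, which covers
    six sign patterns.\<close>
  have 1: "h * (g * h) \<approx> (g * h) * g"
    using m cong_braid[of "m - 1"] by (simp add: g_def h_def mult.assoc)
  have 2: "(g * h) * g' \<approx> h' * (g * h)"
    by (rule cong_conjugate[OF hi(1) gi(2) 1]) (auto simp: F)
  have 3: "(h * g) * h' \<approx> g' * (h * g)"
    by (rule cong_conjugate[OF gi(1) hi(2)]) (use cong_sym[OF 1] in \<open>auto simp: F mult.assoc\<close>)
  have 4: "(g * h') * g' \<approx> h' * (g' * h)"
    by (rule cong_conjugate[OF hi(1) gi(2)]) (use 3 in \<open>auto simp: F mult.assoc\<close>)
  have 5: "(h * g') * h' \<approx> g' * (h' * g)"
    by (rule cong_conjugate[OF gi(1) hi(2)]) (use 2 in \<open>auto simp: F mult.assoc\<close>)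
  have 6: "(h' * g') * h' \<approx> g' * (h' * g')"
    by (rule cong_conjugate[OF gi(1) hi(2)]) (use 4 in \<open>auto simp: F mult.assoc\<close>)
  have flank: "a * x * b \<in> bmw_span n r q m"
    if "a \<in> {h, h'}" "b \<in> {h, h'}" "x \<in> {g, g'}" for a b x
    using that hm m bmw_span.flank[of a m b x] by (auto simp: g_def g'_def)
  have ghg: "g * h * g \<in> bmw_span n r q m"
    by (rule bmw_span.cong[OF flank[of h h g]]) (use 1 in \<open>auto simp: mult.assoc\<close>)
  have ghg': "g * h * g' \<in> bmw_span n r q m"
    by (rule bmw_span.cong[OF flank[of h' h g]]) (use 2 cong_sym in \<open>auto simp: mult.assoc\<close>)
  have g'hg: "g' * h * g \<in> bmw_span n r q m"
    by (rule bmw_span.cong[OF flank[of h h' g]]) (use 3 in \<open>auto simp: mult.assoc\<close>)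
  have gh'g': "g * h' * g' \<in> bmw_span n r q m"
    by (rule bmw_span.cong[OF flank[of h' h g']]) (use 4 cong_sym in \<open>auto simp: mult.assoc\<close>)
  have g'h'g: "g' * h' * g \<in> bmw_span n r q m"
    by (rule bmw_span.cong[OF flank[of h h' g']]) (use 5 in \<open>auto simp: mult.assoc\<close>)
  have g'h'g': "g' * h' * g' \<in> bmw_span n r q m"
    by (rule bmw_span.cong[OF flank[of h' h' g']]) (use 6 in \<open>auto simp: mult.assoc\<close>)

  define Z where "Z = scalar (q - inverse q)"
  define E where "E = Z - g + g'"
  have Z: "Z \<in> free_carrier k" for k by (simp add: Z_def)
  have E: "E \<in> bmw_span n r q m" and Ee: "E = Z * gen_e q m"
    using m scalar_gen_e_span[of m] scalar_gen_e[of m] by (auto simp: E_def Z_def g_def g'_def)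
  txt \<open>The braid relations do not move \<open>g h\<^sup>-\<^sup>1 g\<close> and \<open>g\<^sup>-\<^sup>1 h g\<^sup>-\<^sup>1\<close>; these are the only remaining terms in the
    expansions of the relations \<open>e h\<^sup>\<plusminus>\<^sup>1 e = r\<^sup>\<plusminus>\<^sup>1 e\<close>.\<close>
  have EE: "E * p * E \<in> bmw_span n r q m"
    if *: "gen_e q m * p * gen_e q m \<approx> scalar s * gen_e q m" and "p \<in> {h, h'}" for p s
  proof -
    \<comment> \<open>The factor Z^2 turns both copies of e into E, while the right side of (R2)
      becomes a scalar multiple of E.\<close>
    have "Z * Z * (scalar s * gen_e q m) \<approx> Z * Z * (gen_e q m * p * gen_e q m)"
      by (intro cong_mult_left cong_sym[OF *]) (simp add: Z)
    also have "Z * Z * (gen_e q m * p * gen_e q m) = Z * (Z * (gen_e q m * p)) * gen_e q m"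
      by (simp only: mult.assoc)
    also have "Z * (gen_e q m * p) = gen_e q m * p * Z"
      unfolding Z_def by (rule scalar_commute)
    also have "Z * (gen_e q m * p * Z) * gen_e q m = E * p * E"
      by (simp only: Ee mult.assoc)
    also have "Z * Z * (scalar s * gen_e q m) = Z * (Z * scalar s) * gen_e q m"
      by (simp only: mult.assoc)
    also have "Z * scalar s = scalar s * Z"
      unfolding Z_def by (rule scalar_commute)
    also have "Z * (scalar s * Z) * gen_e q m = Z * scalar s * E"
      by (simp only: Ee mult.assoc)
    finally have "Z * scalar s * E \<approx> E * p * E" .
    from bmw_span.cong[OF bmw_span_mult_left[OF m(2) E] this] show ?thesis using Z by simp
  qed
  have ehe: "gen_e q m * h * gen_e q m \<approx> scalar r * gen_e q m"
    "gen_e q m * h' * gen_e q m \<approx> scalar (inverse r) * gen_e q m"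
    unfolding h_def h'_def using m cong_gen_e_sandwich[of m] by auto
  have expand: "E * p * E = Z * p * Z - Z * p * g + Z * p * g' - g * p * Z + g * p * g - g * p * g'
    + g' * p * Z - g' * p * g + g' * p * g'" for p
    by (simp add: E_def algebra_simps)
  have short: "Z * p * Z \<in> bmw_span n r q m" "Z * p * x \<in> bmw_span n r q m" "x * p * Z \<in> bmw_span n r q m"
    if "p \<in> {h, h'}" "x \<in> {g, g'}" for p x
  proof -
    have p: "p \<in> free_carrier m" and x: "1 \<le> m" "x \<in> {gen m, gen_inv m}"
      using that hm m by (auto simp: g_def g'_def)
    show "Z * p * Z \<in> bmw_span n r q m" using p Z by (simp add: free_carrier_bmw_span)
    show "Z * p * x \<in> bmw_span n r q m" "x * p * Z \<in> bmw_span n r q m"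
      using bmw_span.flank[of "Z * p" m 1 x] bmw_span.flank[of 1 m "p * Z" x] p x Z
      by (auto simp: mult.assoc)
  qed
  have g'hg': "g' * h * g' \<in> bmw_span n r q m"
  proof -
    have "g' * h * g' = E * h * E - Z * h * Z + Z * h * g - Z * h * g' + g * h * Z - g * h * g
      + g * h * g' - g' * h * Z + g' * h * g"
      by (simp add: expand)
    also have "\<dots> \<in> bmw_span n r q m"
      by (intro bmw_span.add bmw_span_diff m short EE[OF ehe(1)] ghg ghg' g'hg) auto
    finally show ?thesis .
  qed
  have gh'g: "g * h' * g \<in> bmw_span n r q m"
  proof -
    have "g * h' * g = E * h' * E - Z * h' * Z + Z * h' * g - Z * h' * g' + g * h' * Z
      + g * h' * g' - g' * h' * Z + g' * h' * g - g' * h' * g'"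
      by (simp add: expand)
    also have "\<dots> \<in> bmw_span n r q m"
      by (intro bmw_span.add bmw_span_diff m short EE[OF ehe(2)] gh'g' g'h'g g'h'g') auto
    finally show ?thesis .
  qed
  show ?thesis
    using c p ghg ghg' g'hg g'hg' gh'g gh'g' g'h'g g'h'g'
    by (auto simp: g_def g'_def h_def h'_def)
qed

text \<open>A form a p b at level m - 1 has outer factors in letters of index at most m - 2. These
  commute with g_m and can be pulled outside, leaving only c p d to reduce.\<close>

lemma gen_flank_span:
  assumes "1 \<le> m" "m < n"
    and c: "c \<in> {gen m, gen_inv m}" "d \<in> {gen m, gen_inv m}"
    and b: "b \<in> bmw_span n r q (m - 1)"
  shows "c * b * d \<in> bmw_span n r q m"
  using b
proof (induction rule: bmw_span.induct)
  case (flank a b p)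
  have cd: "c \<in> free_carrier n" "d \<in> free_carrier n" using assms by auto
  have ab: "a \<in> free_carrier m" "b \<in> free_carrier m" "a \<in> free_carrier n" "b \<in> free_carrier n"
    using flank assms free_carrier_mono[of "m - 1" m] free_carrier_mono[of "m - 1" n] by auto
  have p: "p \<in> free_carrier n" using flank assms by auto
  have "c * p * d \<in> bmw_span n r q m"
  proof (cases "p = 1")
    case True
    then show ?thesis
      using c gen_square_span[OF assms(1,2)] bmw_span.cong[OF free_carrier_bmw_span[of 1 m]]
        cong_sym[OF cong_left_inverse[OF assms(1,2)]] cong_sym[OF cong_right_inverse[OF assms(1,2)]]
      by auto
  next
    case False
    \<comment> \<open>A middle factor other than 1 forces 1 \<le> m - 1, which is the bound 2 \<le>
      m that the sandwich reduction asks for.\<close>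
    then show ?thesis using flank gen_sandwich_span[of m c d p] assms by auto
  qed
  then have "a * (c * p * d) * b \<in> bmw_span n r q m"
    using ab assms(2) by (blast intro: bmw_span_mult_right bmw_span_mult_left)
  moreover have "a * (c * p * d) * b \<approx> c * (a * p * b) * d"
  proof -
    \<comment> \<open>At m = 1 the element x is a scalar; far commutation starts at m = 2.\<close>
    have comm: "x * y \<approx> y * x" if "x \<in> free_carrier (m - 1)" "y \<in> {gen m, gen_inv m}" for x y
    proof (cases "m = 1")
      case True
      then have "x \<in> free_carrier (Suc 0)" using that free_carrier_mono[of 0 "Suc 0" x] by simp
      then obtain k where "x = scalar k" using free_carrier_Suc_0 by blast
      then show ?thesis
        using that assms by (auto simp: scalar_commute[of k] intro!: cong_refl)
    next
      case False
      then show ?thesis using cong_far_free_carrier[of x m y] that assms by simp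
    qed
    have "a * (c * p * d) * b \<approx> c * a * (p * (b * d))"
      using cong_mult[OF comm[OF flank(1) c(1)] cong_mult_left[OF p cong_sym[OF comm[OF flank(2) c(2)]]]]
      by (simp add: mult.assoc)
    then show ?thesis by (simp add: mult.assoc)
  qed
  ultimately show ?case by (rule bmw_span.cong)
next
  case (add x y)
  then show ?case by (simp add: algebra_simps bmw_span.add)
next
  case (cong x y)
  have "c \<in> free_carrier n" "d \<in> free_carrier n" using assms by auto
  then have "c * x * d \<approx> c * y * d" using cong.hyps(2) by (intro cong_mult_left cong_mult_right)
  with cong.IH show ?case by (rule bmw_span.cong)
qed

text \<open>Induction on the level. In a c b followed by a new top letter d, the induction
  hypothesis puts b into spanning form one level down, and \<open>gen_flank_span\<close> then
  reduces c b d.\<close>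

lemma free_carrier_subset_bmw_span: "m < n \<Longrightarrow> free_carrier (Suc m) \<subseteq> bmw_span n r q m"
proof (induction m)
  case 0
  have "scalar c \<in> bmw_span n r q 0" for c by (rule free_carrier_bmw_span) simp
  then show ?case using free_carrier_Suc_0 by auto
next
  case (Suc m)
  \<comment> \<open>Only the top letter needs this argument; letters of lower index are absorbed by
    the right flanking factor.\<close>
  have step: "x * d \<in> bmw_span n r q (Suc m)"
    if "x \<in> bmw_span n r q (Suc m)" "d \<in> {gen (Suc m), gen_inv (Suc m)}" for x d
    using that(1)
  proof (induction rule: bmw_span.induct)
    case (flank a b c)
    have b: "b \<in> bmw_span n r q m" using flank Suc by auto
    show ?case
    proof (cases "c = 1")
      case True
      then show ?thesis using bmw_span.flank[of "a * b" "Suc m" 1 d] flank that(2) by auto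
    next
      case False
      then show ?thesis
        using bmw_span_mult_left[OF Suc.prems gen_flank_span[of "Suc m" c d b] flank(1)]
          b Suc.prems that(2) flank by (simp add: mult.assoc)
    qed
  next
    case (add x y)
    then show ?case by (simp add: algebra_simps bmw_span.add)
  next
    case (cong x y)
    have "d \<in> free_carrier n" using that(2) Suc.prems by auto
    from bmw_span.cong[OF cong.IH cong_mult_right[OF this cong.hyps(2)]] show ?case .
  qed
  have "x \<in> bmw_span n r q (Suc m)" if "x \<in> free_carrier (Suc (Suc m))" for x
    using that
  proof (induction rule: free_carrier_induct)
    case (scalar c)
    then show ?case by (rule free_carrier_bmw_span) simp
  next
    case (add a b)
    then show ?case by (intro bmw_span.add)
  next
    case (gen a i)
    then show ?case
      using step[of a "gen i"] bmw_span_mult_right[OF Suc.prems, of a "gen i"] by (cases "i = Suc m") auto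
  next
    case (gen_inv a i)
    then show ?case
      using step[of a "gen_inv i"] bmw_span_mult_right[OF Suc.prems, of a "gen_inv i"] by (cases "i = Suc m") auto
  qed
  then show ?case by auto
qed

text \<open>Intended for D the difference of two functionals with the same Markov factors. The
  Markov hypothesis then only has to pass on zeros, and the factors themselves disappear from the
  statement.\<close>

lemma markov_functional_vanishes:
  fixes D :: "free_elem \<Rightarrow> complex"
  assumes add: "\<And>a b. a \<in> free_carrier n \<Longrightarrow> b \<in> free_carrier n \<Longrightarrow> D (a + b) = D a + D b"
    and ideal: "\<And>a. a \<in> bmw_ideal n r q \<Longrightarrow> D a = 0"
    and scalar: "\<And>c. D (scalar c) = 0"
    and markov: "\<And>m a b c. 1 \<le> m \<Longrightarrow> m < n \<Longrightarrow> a \<in> free_carrier m \<Longrightarrow> b \<in> free_carrier m \<Longrightarrow>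
      c \<in> {gen m, gen_inv m} \<Longrightarrow> D (a * b) = 0 \<Longrightarrow> D (a * c * b) = 0"
    and "a \<in> free_carrier n"
  shows "D a = 0"
proof -
  have D_cong: "D x = D y" if "x \<approx> y" for x y
    using that add[of "x - y" y] ideal[of "x - y"] by (simp add: bmw_cong_def)
  have "\<forall>a \<in> free_carrier (Suc m). D a = 0" if "Suc m \<le> n" for m
    using that
  proof (induction m)
    case 0
    then show ?case using free_carrier_Suc_0 scalar by auto
  next
    case (Suc m)
    have "D x = 0" if "x \<in> bmw_span n r q (Suc m)" for x
      using that
    proof (induction rule: bmw_span.induct)
      case (flank a b c)
      then have "D (a * b) = 0" using Suc by simp
      then show ?case using flank markov[of "Suc m" a b c] Suc.prems by auto
    next
      case (add x y)
      then show ?case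
        using assms(1)[of x y] bmw_span_free_carrier[of "Suc m"] Suc.prems by simp
    next
      case (cong x y)
      then show ?case using D_cong[of x y] by simp
    qed
    then show ?case using free_carrier_subset_bmw_span[of "Suc m"] Suc.prems by auto
  qed
  \<comment> \<open>The induction reaches \<open>Suc (n - 1)\<close>, which equals n only for n
    \<ge> 1; at n = 0 all elements are scalars.\<close>
  from this[of "n - 1"] show ?thesis
    using assms(5) free_carrier_mono[of 0 1 a] free_carrier_Suc_0[of a] scalar
    by (cases n) auto
qed

end

end

section \<open>The inductive limit of the BMW algebras\<close>

lemma mem_bmw_incl_iff:
  assumes "a \<in> free_carrier n"
  shows "(m, X) \<in> bmw_incl r q n (bmw_elem r q n a) \<longleftrightarrow>
    (\<exists>b \<in> free_carrier m. X = bmw_elem r q m b \<and> (\<exists>k. n \<le> k \<and> m \<le> k \<and> a - b \<in> bmw_ideal k r q))"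
proof -
  have "bmw_map r q n k (bmw_elem r q n a) = bmw_map r q m k (bmw_elem r q m b) \<longleftrightarrow>
      a - b \<in> bmw_ideal k r q" if "b \<in> free_carrier m" "n \<le> k" "m \<le> k" for b k
    using assms that free_carrier_mono[of n k a] free_carrier_mono[of m k b]
    by (simp add: bmw_map_elem bmw_elem_eq_iff)
  then show ?thesis
    unfolding bmw_incl_def lim_class_def carrier_bmw by auto
qed

lemma bmw_incl_eqI:
  assumes "a \<in> free_carrier n" "b \<in> free_carrier m" "n \<le> k" "m \<le> k" "a - b \<in> bmw_ideal k r q"
  shows "bmw_incl r q n (bmw_elem r q n a) = bmw_incl r q m (bmw_elem r q m b)"
proof -
  have *: "bmw_incl r q n (bmw_elem r q n a) \<subseteq> bmw_incl r q m (bmw_elem r q m b)"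
    if asm: "a \<in> free_carrier n" "b \<in> free_carrier m" "n \<le> k" "m \<le> k" "a - b \<in> bmw_ideal k r q"
    for a b n m k
  proof (clarify, unfold mem_bmw_incl_iff[OF asm(1)] mem_bmw_incl_iff[OF asm(2)], elim bexE conjE exE)
    fix l X d k'
    assume d: "d \<in> free_carrier l" "X = bmw_elem r q l d" "n \<le> k'" "l \<le> k'" "a - d \<in> bmw_ideal k' r q"
    \<comment> \<open>Equalities witnessed at two different stages are compared at the later one,
      since the ideals grow with the stage.\<close>
    have "a - d \<in> bmw_ideal (max k k') r q" "a - b \<in> bmw_ideal (max k k') r q"
      using d(5) asm(5) bmw_ideal_mono[of k' "max k k'" r q] bmw_ideal_mono[of k "max k k'" r q] by auto
    from bmw_ideal_diff[OF this] have "b - d \<in> bmw_ideal (max k k') r q" by simp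
    then show "\<exists>d\<in>free_carrier l. X = bmw_elem r q l d \<and>
        (\<exists>k. m \<le> k \<and> l \<le> k \<and> b - d \<in> bmw_ideal k r q)"
      using d asm by (intro bexI[of _ d] conjI exI[of _ "max k k'"]) auto
  qed
  have "b - a \<in> bmw_ideal k r q" using bmw_ideal_uminus[OF assms(5)] by simp
  with * assms show ?thesis by (intro subset_antisym) blast+
qed

lemma bmw_incl_mono:
  assumes "a \<in> free_carrier m" "m \<le> n"
  shows "bmw_incl r q m (bmw_elem r q m a) = bmw_incl r q n (bmw_elem r q n a)"
  using assms free_carrier_mono[of m n a] by (intro bmw_incl_eqI[where k = n]) auto

lemma bmw_incl_closed:
  "a \<in> free_carrier n \<Longrightarrow> bmw_incl r q n (bmw_elem r q n a) \<in> carrier (bmw_lim r q)"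
  by (auto simp: bmw_lim_def lim_algebra_def bmw_incl_def carrier_bmw)

lemma self_mem_bmw_incl:
  "a \<in> free_carrier n \<Longrightarrow> (n, bmw_elem r q n a) \<in> bmw_incl r q n (bmw_elem r q n a)"
  by (auto simp: mem_bmw_incl_iff intro!: bexI[of _ a] exI[of _ n])

lemma mult_bmw_lim:
  assumes a: "a \<in> free_carrier n" and b: "b \<in> free_carrier n"
  shows "bmw_incl r q n (bmw_elem r q n a) \<otimes>\<^bsub>bmw_lim r q\<^esub> bmw_incl r q n (bmw_elem r q n b) =
    bmw_incl r q n (bmw_elem r q n (a * b))"
proof -
  have "bmw_incl r q (max k l) (bmw_map r q k (max k l) X \<otimes>\<^bsub>bmw r q (max k l)\<^esub> bmw_map r q l (max k l) Y)
      = bmw_incl r q n (bmw_elem r q n (a * b))" (is "bmw_incl r q ?m _ = _")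
    if X: "(k, X) \<in> bmw_incl r q n (bmw_elem r q n a)" and Y: "(l, Y) \<in> bmw_incl r q n (bmw_elem r q n b)"
    for k X l Y
  proof -
    from X a obtain a' i where a': "a' \<in> free_carrier k" "X = bmw_elem r q k a'" "n \<le> i" "k \<le> i"
        "a - a' \<in> bmw_ideal i r q"
      by (auto simp: mem_bmw_incl_iff)
    from Y b obtain b' j where b': "b' \<in> free_carrier l" "Y = bmw_elem r q l b'" "n \<le> j" "l \<le> j"
        "b - b' \<in> bmw_ideal j r q"
      by (auto simp: mem_bmw_incl_iff)
    have F: "a' \<in> free_carrier ?m" "b' \<in> free_carrier ?m"
      using a' b' free_carrier_mono[of k ?m] free_carrier_mono[of l ?m] by auto
    have "bmw_map r q k ?m X \<otimes>\<^bsub>bmw r q ?m\<^esub> bmw_map r q l ?m Y = bmw_elem r q ?m (a' * b')"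
      using a' b' F by (simp add: bmw_map_elem mult_bmw)
    moreover have "bmw_incl r q ?m (bmw_elem r q ?m (a' * b')) = bmw_incl r q n (bmw_elem r q n (a * b))"
    proof (rule bmw_incl_eqI[symmetric])
      have "a - a' \<in> bmw_ideal (max i j) r q" "b - b' \<in> bmw_ideal (max i j) r q"
        using a' b' bmw_ideal_mono[of i "max i j" r q] bmw_ideal_mono[of j "max i j" r q] by auto
      moreover have "b \<in> free_carrier (max i j)" "a' \<in> free_carrier (max i j)"
        using a' b b' free_carrier_mono[of n "max i j" b] free_carrier_mono[of k "max i j" a'] by auto
      \<comment> \<open>The usual telescoping of a b - a' b', so that each summand has one factor in
        the ideal.\<close>
      ultimately have "(a - a') * b + a' * (b - b') \<in> bmw_ideal (max i j) r q"
        by (intro bmw_ideal_add bmw_ideal_mult_left bmw_ideal_mult_right)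
      then show "a * b - a' * b' \<in> bmw_ideal (max i j) r q" by (simp add: algebra_simps)
    qed (use a b F a' b' in auto)
    ultimately show ?thesis by simp
  qed
  note const = this
  show ?thesis
    unfolding bmw_lim_def lim_algebra_def monoid.simps ring.simps module.simps
    by (rule UN_eq_const[OF self_mem_bmw_incl[OF a]], clarify,
        rule UN_eq_const[OF self_mem_bmw_incl[OF b]], clarify, unfold Let_def, fold bmw_incl_def)
      (rule const, assumption+)
qed

lemma add_bmw_lim:
  assumes a: "a \<in> free_carrier n" and b: "b \<in> free_carrier n"
  shows "bmw_incl r q n (bmw_elem r q n a) \<oplus>\<^bsub>bmw_lim r q\<^esub> bmw_incl r q n (bmw_elem r q n b) =
    bmw_incl r q n (bmw_elem r q n (a + b))"
proof -
  have "bmw_incl r q (max k l) (bmw_map r q k (max k l) X \<oplus>\<^bsub>bmw r q (max k l)\<^esub> bmw_map r q l (max k l) Y)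
      = bmw_incl r q n (bmw_elem r q n (a + b))" (is "bmw_incl r q ?m _ = _")
    if X: "(k, X) \<in> bmw_incl r q n (bmw_elem r q n a)" and Y: "(l, Y) \<in> bmw_incl r q n (bmw_elem r q n b)"
    for k X l Y
  proof -
    from X a obtain a' i where a': "a' \<in> free_carrier k" "X = bmw_elem r q k a'" "n \<le> i" "k \<le> i"
        "a - a' \<in> bmw_ideal i r q"
      by (auto simp: mem_bmw_incl_iff)
    from Y b obtain b' j where b': "b' \<in> free_carrier l" "Y = bmw_elem r q l b'" "n \<le> j" "l \<le> j"
        "b - b' \<in> bmw_ideal j r q"
      by (auto simp: mem_bmw_incl_iff)
    have F: "a' \<in> free_carrier ?m" "b' \<in> free_carrier ?m"
      using a' b' free_carrier_mono[of k ?m] free_carrier_mono[of l ?m] by auto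
    have "bmw_map r q k ?m X \<oplus>\<^bsub>bmw r q ?m\<^esub> bmw_map r q l ?m Y = bmw_elem r q ?m (a' + b')"
      using a' b' F by (simp add: bmw_map_elem add_bmw)
    moreover have "bmw_incl r q ?m (bmw_elem r q ?m (a' + b')) = bmw_incl r q n (bmw_elem r q n (a + b))"
    proof (rule bmw_incl_eqI[symmetric])
      have "a - a' \<in> bmw_ideal (max i j) r q" "b - b' \<in> bmw_ideal (max i j) r q"
        using a' b' bmw_ideal_mono[of i "max i j" r q] bmw_ideal_mono[of j "max i j" r q] by auto
      then have "(a - a') + (b - b') \<in> bmw_ideal (max i j) r q" by (rule bmw_ideal_add)
      then show "a + b - (a' + b') \<in> bmw_ideal (max i j) r q" by (simp add: algebra_simps)
    qed (use a b F a' b' in auto)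
    ultimately show ?thesis by simp
  qed
  note const = this
  show ?thesis
    unfolding bmw_lim_def lim_algebra_def monoid.simps ring.simps module.simps
    by (rule UN_eq_const[OF self_mem_bmw_incl[OF a]], clarify,
        rule UN_eq_const[OF self_mem_bmw_incl[OF b]], clarify, unfold Let_def, fold bmw_incl_def)
      (rule const, assumption+)
qed

lemma smult_bmw_lim:
  assumes a: "a \<in> free_carrier n"
  shows "c \<odot>\<^bsub>bmw_lim r q\<^esub> bmw_incl r q n (bmw_elem r q n a) = bmw_incl r q n (bmw_elem r q n (scalar c * a))"
proof -
  have "bmw_incl r q k (c \<odot>\<^bsub>bmw r q k\<^esub> X) = bmw_incl r q n (bmw_elem r q n (scalar c * a))"
    if X: "(k, X) \<in> bmw_incl r q n (bmw_elem r q n a)" for k X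
  proof -
    from X a obtain a' i where a': "a' \<in> free_carrier k" "X = bmw_elem r q k a'" "n \<le> i" "k \<le> i"
        "a - a' \<in> bmw_ideal i r q"
      by (auto simp: mem_bmw_incl_iff)
    have "bmw_incl r q k (bmw_elem r q k (scalar c * a')) = bmw_incl r q n (bmw_elem r q n (scalar c * a))"
    proof (rule bmw_incl_eqI[symmetric])
      show "scalar c * a - scalar c * a' \<in> bmw_ideal i r q"
        using bmw_ideal_mult_left[OF a'(5) free_carrier_scalar[of c]] by (simp add: algebra_simps)
    qed (use a a' in auto)
    then show ?thesis using a' by (simp add: smult_bmw)
  qed
  note const = this
  show ?thesis
    unfolding bmw_lim_def lim_algebra_def monoid.simps ring.simps module.simps
    by (rule UN_eq_const[OF self_mem_bmw_incl[OF a]], clarify, fold bmw_incl_def)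
      (rule const)
qed

lemma one_bmw_lim: "\<one>\<^bsub>bmw_lim r q\<^esub> = bmw_incl r q n (bmw_elem r q n 1)"
  using bmw_incl_mono[of 1 0 n r q]
  by (simp add: bmw_lim_def lim_algebra_def one_bmw bmw_incl_def)

text \<open>The relation \<open>g\<^sup>-\<^sup>1 = g - (q - q\<^sup>-\<^sup>1)(1 - e)\<close> extends the Markov property to inverse generators.\<close>

lemma bmw_trace_markov:
  fixes r q :: complex and tr :: "bmw_lim_elem \<Rightarrow> complex"
  assumes tr: "is_bmw_trace r q tr" and q: "q - inverse q \<noteq> 0"
    and x: "x = 1 + (r - inverse r) / (q - inverse q)"
  defines "T \<equiv> \<lambda>n a. tr (bmw_incl r q n (bmw_elem r q n a))"
  shows "a \<in> free_carrier n \<Longrightarrow> b \<in> free_carrier n \<Longrightarrow> T n (a + b) = T n a + T n b"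
    and "a \<in> free_carrier n \<Longrightarrow> T n (scalar c * a) = c * T n a"
    and "T n 1 = 1"
    and "a \<in> bmw_ideal n r q \<Longrightarrow> T n a = 0"
    and "1 \<le> m \<Longrightarrow> m < n \<Longrightarrow> a \<in> free_carrier m \<Longrightarrow> b \<in> free_carrier m \<Longrightarrow>
      T n (a * gen m * b) = r / x * T n (a * b)"
    and "1 \<le> m \<Longrightarrow> m < n \<Longrightarrow> a \<in> free_carrier m \<Longrightarrow> b \<in> free_carrier m \<Longrightarrow>
      T n (a * gen_inv m * b) = (r / x - (q - inverse q) * (1 - 1 / x)) * T n (a * b)"
proof -
  have lin: "linear_functional (bmw_lim r q) tr" and one: "tr \<one>\<^bsub>bmw_lim r q\<^esub> = 1"
    and e: "\<And>i. 1 \<le> i \<Longrightarrow> tr (lim_e r q i) = 1 / x" and g: "\<And>i. 1 \<le> i \<Longrightarrow> tr (lim_g r q i) = r / x"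
    and markov: "\<And>n a b c. 2 \<le> n \<Longrightarrow> a \<in> bmw_incl r q (n - 1) ` carrier (bmw r q (n - 1)) \<Longrightarrow>
       b \<in> bmw_incl r q (n - 1) ` carrier (bmw r q (n - 1)) \<Longrightarrow>
       c \<in> {lim_g r q (n - 1), lim_e r q (n - 1)} \<Longrightarrow>
       tr (a \<otimes>\<^bsub>bmw_lim r q\<^esub> c \<otimes>\<^bsub>bmw_lim r q\<^esub> b) = tr c * tr (a \<otimes>\<^bsub>bmw_lim r q\<^esub> b)"
    using tr unfolding is_bmw_trace_def Let_def x by blast+
  show add: "T n (a + b) = T n a + T n b" if "a \<in> free_carrier n" "b \<in> free_carrier n" for n a b
    using lin that bmw_incl_closed
    by (simp add: T_def add_bmw_lim[symmetric] linear_functional_def)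
  show smult: "T n (scalar c * a) = c * T n a" if "a \<in> free_carrier n" for n c a
    using lin that bmw_incl_closed
    by (simp add: T_def smult_bmw_lim[symmetric] linear_functional_def)
  show "T n 1 = 1" using one by (simp add: T_def one_bmw_lim[of r q n])
  have "T n 0 = 0" using smult[of 0 n 0] by simp
  then show "T n a = 0" if "a \<in> bmw_ideal n r q"
    using that bmw_elem_eq_iff[of a n 0 r q] bmw_ideal_carrier[OF that] by (simp add: T_def)
  have flank: "T n (a * c * b) = tr (bmw_incl r q (m + 1) (bmw_elem r q (m + 1) c)) * T n (a * b)"
    if m: "1 \<le> m" "m < n" and ab: "a \<in> free_carrier m" "b \<in> free_carrier m"
      and c: "c \<in> {gen m, gen_e q m}" for m n a b c
  proof -
    have F: "a \<in> free_carrier n" "b \<in> free_carrier n" "c \<in> free_carrier n" "c \<in> free_carrier (m + 1)"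
      using m ab c free_carrier_mono[of m n] by auto
    have im: "bmw_incl r q n (bmw_elem r q n d) \<in> bmw_incl r q m ` carrier (bmw r q m)"
      if "d \<in> free_carrier m" for d
      using that m bmw_incl_mono[of d m n r q, symmetric] by (auto simp: carrier_bmw)
    have incl: "bmw_incl r q (m + 1) (bmw_elem r q (m + 1) c) = bmw_incl r q n (bmw_elem r q n c)"
      using F m by (intro bmw_incl_mono) auto
    then have "bmw_incl r q n (bmw_elem r q n c) \<in> {lim_g r q m, lim_e r q m}"
      using c by (auto simp: lim_g_def lim_e_def)
    \<comment> \<open>The Markov axiom at index k concerns g_(k-1) and C_(k-1), hence the instance k
      = m + 1.\<close>
    then show ?thesis
      using markov[of "m + 1", OF _ _ _ , of "bmw_incl r q n (bmw_elem r q n a)"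
          "bmw_incl r q n (bmw_elem r q n b)" "bmw_incl r q n (bmw_elem r q n c)"]
        im[OF ab(1)] im[OF ab(2)] m F
      unfolding incl T_def by (simp add: mult_bmw_lim)
  qed
  show gen: "T n (a * gen m * b) = r / x * T n (a * b)"
    if "1 \<le> m" "m < n" "a \<in> free_carrier m" "b \<in> free_carrier m" for a b
    using flank[OF that] g[OF that(1)] by (simp add: lim_g_def)
  show "T n (a * gen_inv m * b) = (r / x - (q - inverse q) * (1 - 1 / x)) * T n (a * b)"
    if m: "1 \<le> m" "m < n" and ab: "a \<in> free_carrier m" "b \<in> free_carrier m" for a b
  proof -
    define z where "z = q - inverse q"
    have F: "a \<in> free_carrier n" "b \<in> free_carrier n"
      using m ab free_carrier_mono[of m n] by auto
    have z: "scalar z * (scalar (1 / z) * y) = y" for y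
      using q by (simp add: mult.assoc[symmetric] scalar_mult[symmetric] z_def)
    have "gen_inv m = gen m + scalar (- z) * 1 + scalar z * gen_e q m"
      by (simp add: gen_e_def algebra_simps z z_def[symmetric] scalar_uminus)
    then have "a * gen_inv m * b = a * gen m * b + a * scalar (- z) * b + a * scalar z * gen_e q m * b"
      by (simp add: algebra_simps)
    also have "\<dots> = a * gen m * b + scalar (- z) * (a * b) + scalar z * (a * gen_e q m * b)"
      by (simp add: scalar_commute[of _ a, symmetric] mult.assoc)
    finally have "T n (a * gen_inv m * b) =
        T n (a * gen m * b) + - z * T n (a * b) + z * T n (a * gen_e q m * b)"
      using F m by (simp add: add smult)
    also have "T n (a * gen_e q m * b) = 1 / x * T n (a * b)"
      using flank[OF m ab, of "gen_e q m"] e[OF m(1)] by (simp add: lim_e_def)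
    \<comment> \<open>Since (q - q^-1)(x - 1) = r - r^-1, the constant equals r^-1/x whenever x is
      nonzero; the unexpanded form avoids that case distinction.\<close>
    finally show ?thesis
      unfolding gen[OF m ab] z_def[symmetric] by (simp add: algebra_simps)
  qed
qed

section \<open>Kronecker products and traces\<close>

text \<open>The indexing convention of \<open>kronecker\<close>: the left factor is indexed by the
  quotient, the right factor by the remainder.\<close>

lemma sum_div_mod:
  fixes f :: "nat \<Rightarrow> nat \<Rightarrow> 'a :: comm_monoid_add"
  shows "(\<Sum>k<a * b. f (k div b) (k mod b)) = (\<Sum>i<a. \<Sum>j<b. f i j)"
proof -
  have "(\<Sum>i<a. \<Sum>j<b. f i j) = (\<Sum>(i, j)\<in>{..<a} \<times> {..<b}. f i j)"
    by (rule sum.cartesian_product)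
  also have "\<dots> = (\<Sum>k<a * b. f (k div b) (k mod b))"
  proof (rule sum.reindex_bij_witness[where i = "\<lambda>k. (k div b, k mod b)" and j = "\<lambda>(i, j). i * b + j"])
    fix k assume k: "k \<in> {..<a * b}"
    then have "b > 0" by (cases b) auto
    with k show "(k div b, k mod b) \<in> {..<a} \<times> {..<b}"
      by (auto simp: less_mult_imp_div_less)
  next
    fix p assume "p \<in> {..<a} \<times> {..<b}"
    then obtain i j where p: "p = (i, j)" "i < a" "j < b" by auto
    then have "i * b + j < (i + 1) * b" by simp
    also have "\<dots> \<le> a * b" using p by (intro mult_le_mono1) simp
    finally show "(case p of (i, j) \<Rightarrow> i * b + j) \<in> {..<a * b}" using p by simp
  qed auto
  finally show ?thesis by simp
qed

lemma sum_lessThan_2: "(\<Sum>k<2. f k) = f 0 + f (1 :: nat)"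
  by (simp add: numeral_2_eq_2)

lemma kronecker_carrier [simp]:
  "A \<in> carrier_mat a b \<Longrightarrow> B \<in> carrier_mat c d \<Longrightarrow> A \<otimes>\<^sub>K B \<in> carrier_mat (a * c) (b * d)"
  by (auto simp: kronecker_def)

lemma index_kronecker:
  assumes "A \<in> carrier_mat a b" "B \<in> carrier_mat c d" "i < a * c" "j < b * d"
  shows "(A \<otimes>\<^sub>K B) $$ (i, j) = A $$ (i div c, j div d) * B $$ (i mod c, j mod d)"
  using assms by (auto simp: kronecker_def)

lemma div_mod_bounds: "i < a * c \<Longrightarrow> i div c < a \<and> i mod c < (c :: nat)"
  by (cases "c = 0") (auto simp: less_mult_imp_div_less)

lemma index_mult_mat_sum:
  assumes "A \<in> carrier_mat a b" "B \<in> carrier_mat b c" "i < a" "j < c"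
  shows "(A * B) $$ (i, j) = (\<Sum>k<b. A $$ (i, k) * B $$ (k, j))"
  using assms by (auto simp: scalar_prod_def atLeast0LessThan intro!: sum.cong)

lemma kronecker_mult:
  assumes A: "A \<in> carrier_mat a b" and B: "B \<in> carrier_mat c d"
    and C: "C \<in> carrier_mat b e" and D: "D \<in> carrier_mat d f"
  shows "(A \<otimes>\<^sub>K B) * (C \<otimes>\<^sub>K D) = (A * C) \<otimes>\<^sub>K (B * D)"
proof (rule eq_matI)
  fix i j assume "i < dim_row ((A * C) \<otimes>\<^sub>K (B * D))" "j < dim_col ((A * C) \<otimes>\<^sub>K (B * D))"
  then have ij: "i < a * c" "j < e * f" using assms by (auto simp: kronecker_def)
  note b = div_mod_bounds[OF ij(1)] div_mod_bounds[OF ij(2)]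
  have "((A \<otimes>\<^sub>K B) * (C \<otimes>\<^sub>K D)) $$ (i, j) =
      (\<Sum>k<b * d. A $$ (i div c, k div d) * B $$ (i mod c, k mod d) *
        (C $$ (k div d, j div f) * D $$ (k mod d, j mod f)))"
    using ij by (subst index_mult_mat_sum[OF kronecker_carrier[OF A B] kronecker_carrier[OF C D]])
      (auto simp: index_kronecker[OF A B] index_kronecker[OF C D] intro!: sum.cong)
  also have "\<dots> = (\<Sum>k<b. \<Sum>l<d. A $$ (i div c, k) * B $$ (i mod c, l) *
        (C $$ (k, j div f) * D $$ (l, j mod f)))"
    by (rule sum_div_mod)
  also have "\<dots> = (A * C) $$ (i div c, j div f) * (B * D) $$ (i mod c, j mod f)"
    using b by (subst index_mult_mat_sum[OF A C], simp, simp, subst index_mult_mat_sum[OF B D])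
      (simp_all add: sum_product mult_ac)
  also have "\<dots> = ((A * C) \<otimes>\<^sub>K (B * D)) $$ (i, j)"
    using assms ij by (subst index_kronecker[of _ a e _ c f]) auto
  finally show "((A \<otimes>\<^sub>K B) * (C \<otimes>\<^sub>K D)) $$ (i, j) = ((A * C) \<otimes>\<^sub>K (B * D)) $$ (i, j)" .
qed (use assms in \<open>auto simp: kronecker_def\<close>)

lemma kronecker_assoc: "(A \<otimes>\<^sub>K B) \<otimes>\<^sub>K C = A \<otimes>\<^sub>K (B \<otimes>\<^sub>K C)"
proof (rule eq_matI)
  fix i j assume "i < dim_row (A \<otimes>\<^sub>K (B \<otimes>\<^sub>K C))" "j < dim_col (A \<otimes>\<^sub>K (B \<otimes>\<^sub>K C))"
  then have ij: "i < dim_row A * dim_row B * dim_row C" "j < dim_col A * dim_col B * dim_col C"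
    by (auto simp: kronecker_def mult.assoc)
  have mod_div: "k mod (b * c) div c = k div c mod b" "k mod (b * c) mod c = k mod c" for k b c :: nat
    by (cases "c = 0"; simp add: mod_mult2_eq[of k c b, unfolded mult.commute[of c b]])+
  have "i < dim_row A * (dim_row B * dim_row C)" "j < dim_col A * (dim_col B * dim_col C)"
    using ij by (simp_all add: mult.assoc)
  note b = div_mod_bounds[OF ij(1)] div_mod_bounds[OF ij(2)] this div_mod_bounds[OF this(1)] div_mod_bounds[OF this(2)]
  have "k div (b * c) = k div c div b" for k b c :: nat
    by (simp add: div_mult2_eq[symmetric] mult.commute)
  then show "((A \<otimes>\<^sub>K B) \<otimes>\<^sub>K C) $$ (i, j) = (A \<otimes>\<^sub>K (B \<otimes>\<^sub>K C)) $$ (i, j)"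
    using ij b by (simp add: kronecker_def mod_div mult.assoc[of "_ $$ _"])
qed (auto simp: kronecker_def)

lemma kronecker_one: "1\<^sub>m a \<otimes>\<^sub>K 1\<^sub>m b = 1\<^sub>m (a * b)"
proof (rule eq_matI)
  fix i j assume "i < dim_row (1\<^sub>m (a * b) :: complex mat)" "j < dim_col (1\<^sub>m (a * b) :: complex mat)"
  then have ij: "i < a * b" "j < a * b" by auto
  note bounds = div_mod_bounds[OF ij(1)] div_mod_bounds[OF ij(2)]
  have "i = j \<longleftrightarrow> i div b = j div b \<and> i mod b = j mod b" by (metis div_mult_mod_eq)
  then show "(1\<^sub>m a \<otimes>\<^sub>K 1\<^sub>m b) $$ (i, j) = 1\<^sub>m (a * b) $$ (i, j)"
    using ij bounds by (auto simp: kronecker_def)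
qed (auto simp: kronecker_def)

lemma kronecker_one_one [simp]: "A \<otimes>\<^sub>K 1\<^sub>m 1 = A"
  by (rule eq_matI) (auto simp: kronecker_def)

lemma kronecker_add_left:
  "A \<in> carrier_mat a b \<Longrightarrow> B \<in> carrier_mat a b \<Longrightarrow> (A + B) \<otimes>\<^sub>K C = A \<otimes>\<^sub>K C + B \<otimes>\<^sub>K C"
  by (rule eq_matI) (auto simp: kronecker_def algebra_simps dest!: div_mod_bounds)

lemma kronecker_smult_left: "(c \<cdot>\<^sub>m A) \<otimes>\<^sub>K B = c \<cdot>\<^sub>m (A \<otimes>\<^sub>K B)"
  by (rule eq_matI) (auto simp: kronecker_def algebra_simps dest!: div_mod_bounds)

section \<open>Normalized traces and partial traces\<close>

lemma normalized_trace_add: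
  "A \<in> carrier_mat (2 ^ n) (2 ^ n) \<Longrightarrow> B \<in> carrier_mat (2 ^ n) (2 ^ n) \<Longrightarrow>
   normalized_trace n (A + B) = normalized_trace n A + normalized_trace n B"
  by (simp add: normalized_trace_def sum.distrib algebra_simps)

lemma normalized_trace_smult:
  "A \<in> carrier_mat (2 ^ n) (2 ^ n) \<Longrightarrow> normalized_trace n (c \<cdot>\<^sub>m A) = c * normalized_trace n A"
  by (simp add: normalized_trace_def sum_distrib_left algebra_simps)

lemma normalized_trace_one [simp]: "normalized_trace n (1\<^sub>m (2 ^ n)) = 1"
  by (simp add: normalized_trace_def)

lemma normalized_trace_kronecker_one:
  assumes "A \<in> carrier_mat (2 ^ n) (2 ^ n)"
  shows "normalized_trace (n + k) (A \<otimes>\<^sub>K 1\<^sub>m (2 ^ k)) = normalized_trace n A"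
proof -
  have "(\<Sum>i<2 ^ (n + k). (A \<otimes>\<^sub>K 1\<^sub>m (2 ^ k)) $$ (i, i)) =
      (\<Sum>i<2 ^ n * 2 ^ k. A $$ (i div 2 ^ k, i div 2 ^ k))"
    by (rule sum.cong) (auto simp: power_add index_kronecker[OF assms one_carrier_mat])
  also have "\<dots> = 2 ^ k * (\<Sum>i<2 ^ n. A $$ (i, i))"
    using sum_div_mod[where f = "\<lambda>i j. A $$ (i, i)" and a = "2 ^ n" and b = "2 ^ k"] by (simp add: sum_distrib_left)
  finally show ?thesis by (simp add: normalized_trace_def power_add)
qed

text \<open>The hypothesis says that the partial trace of \<open>X\<close> over the last tensor factor is \<open>c\<close> times the
  identity.\<close>

lemma normalized_trace_markov:
  assumes A: "A \<in> carrier_mat (2 ^ n) (2 ^ n)" and B: "B \<in> carrier_mat (2 ^ n) (2 ^ n)"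
    and X: "X \<in> carrier_mat (2 ^ (n + 1)) (2 ^ (n + 1))"
    and ptrace: "\<And>i j. i < 2 ^ n \<Longrightarrow> j < 2 ^ n \<Longrightarrow>
      (\<Sum>k<2. X $$ (2 * i + k, 2 * j + k)) = (if i = j then c else 0)"
  shows "normalized_trace (n + 1) ((A \<otimes>\<^sub>K 1\<^sub>m 2) * X * (B \<otimes>\<^sub>K 1\<^sub>m 2)) = c / 2 * normalized_trace n (A * B)"
proof -
  let ?N = "2 ^ n :: nat" and ?M = "2 ^ n * 2 :: nat"
  let ?A = "A \<otimes>\<^sub>K 1\<^sub>m 2" and ?B = "B \<otimes>\<^sub>K 1\<^sub>m 2"
  have C: "?A \<in> carrier_mat ?M ?M" "?B \<in> carrier_mat ?M ?M" "X \<in> carrier_mat ?M ?M"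
    using kronecker_carrier[OF A one_carrier_mat[of 2]] kronecker_carrier[OF B one_carrier_mat[of 2]] X
    by (auto simp: mult.commute)
  have split: "(\<Sum>k<?M. f k) = (\<Sum>i<?N. \<Sum>j<2. f (2 * i + j))" for f :: "nat \<Rightarrow> complex"
    using sum_div_mod[where f = "\<lambda>i j. f (2 * i + j)" and a = "2 ^ n" and b = 2] by simp
  have lt: "2 * i + s < ?M" if "i < ?N" "s < 2" for i s using that by linarith
  \<comment> \<open>In an index 2 i + s, i belongs to the first n tensor factors and s to the last
    one.\<close>
  have ent: "(C \<otimes>\<^sub>K 1\<^sub>m 2) $$ (2 * i + s, 2 * j + t) = C $$ (i, j) * (if s = t then 1 else 0)"
    if "C \<in> carrier_mat ?N ?N" "i < ?N" "j < ?N" "s < 2" "t < 2" for C i j s t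
    using that lt[of i s] lt[of j t] by (subst index_kronecker[OF that(1) one_carrier_mat]) auto
  have prod: "(?A * X * ?B) $$ (k, k) = (\<Sum>l<?M. \<Sum>m<?M. ?A $$ (k, l) * X $$ (l, m) * ?B $$ (m, k))"
    if k: "k < ?M" for k
  proof -
    have "(?A * X * ?B) $$ (k, k) = (\<Sum>m<?M. (?A * X) $$ (k, m) * ?B $$ (m, k))"
      by (rule index_mult_mat_sum[OF mult_carrier_mat[OF C(1,3)] C(2) k k])
    also have "\<dots> = (\<Sum>m<?M. \<Sum>l<?M. ?A $$ (k, l) * X $$ (l, m) * ?B $$ (m, k))"
      using k by (intro sum.cong HOL.refl) (simp add: index_mult_mat_sum[OF C(1,3)] sum_distrib_right del: index_mult_mat)
    finally show ?thesis by (subst sum.swap)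
  qed
  \<comment> \<open>The identities in the last factor of A and B force all three last-factor indices
    to agree.\<close>
  have diagonal: "(\<Sum>t<2. \<Sum>k<?N. \<Sum>u<2. if s = t \<and> u = s then f t k u else 0) = (\<Sum>k<?N. f s k s)"
    if "s < 2" for s :: nat and f :: "nat \<Rightarrow> nat \<Rightarrow> nat \<Rightarrow> complex"
  proof -
    from that have "s = 0 \<or> s = 1" by auto
    then show ?thesis by (elim disjE) (simp_all add: sum_lessThan_2)
  qed
  have "(\<Sum>k<?M. (?A * X * ?B) $$ (k, k)) =
      (\<Sum>k<?M. \<Sum>l<?M. \<Sum>m<?M. ?A $$ (k, l) * X $$ (l, m) * ?B $$ (m, k))"
    by (intro sum.cong HOL.refl prod) auto
  also have "\<dots> = (\<Sum>i<?N. \<Sum>s<2. \<Sum>j<?N. \<Sum>t<2. \<Sum>k<?N. \<Sum>u<2.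
      ?A $$ (2 * i + s, 2 * j + t) * X $$ (2 * j + t, 2 * k + u) * ?B $$ (2 * k + u, 2 * i + s))"
    by (simp only: split)
  also have "\<dots> = (\<Sum>i<?N. \<Sum>s<2. \<Sum>j<?N. \<Sum>t<2. \<Sum>k<?N. \<Sum>u<2.
      (if s = t \<and> u = s then A $$ (i, j) * X $$ (2 * j + t, 2 * k + u) * B $$ (k, i) else 0))"
    by (intro sum.cong HOL.refl) (auto simp: ent[OF A] ent[OF B])
  also have "\<dots> = (\<Sum>i<?N. \<Sum>s<2. \<Sum>j<?N. \<Sum>k<?N.
      A $$ (i, j) * X $$ (2 * j + s, 2 * k + s) * B $$ (k, i))"
    by (rule sum.cong[OF HOL.refl])+ (rule diagonal, simp)
  \<comment> \<open>Moving the last-factor index innermost exposes the partial trace of X.\<close>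
  also have "\<dots> = (\<Sum>i<?N. \<Sum>j<?N. \<Sum>k<?N. \<Sum>s<2.
      A $$ (i, j) * X $$ (2 * j + s, 2 * k + s) * B $$ (k, i))"
    by (simp add: sum_lessThan_2 sum.distrib)
  also have "\<dots> = (\<Sum>i<?N. \<Sum>j<?N. \<Sum>k<?N. A $$ (i, j) * (if j = k then c else 0) * B $$ (k, i))"
    by (intro sum.cong HOL.refl) (simp add: ptrace[symmetric] sum_distrib_left sum_distrib_right)
  also have "\<dots> = (\<Sum>i<?N. \<Sum>j<?N. c * (A $$ (i, j) * B $$ (j, i)))"
    by (intro sum.cong HOL.refl) (simp add: if_distrib[of "\<lambda>x. _ * x"] if_distrib[of "\<lambda>x. x * _"] sum.delta cong: if_cong)
  also have "\<dots> = c * (\<Sum>i<?N. (A * B) $$ (i, i))"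
    by (simp add: index_mult_mat_sum[OF A B] sum_distrib_left del: index_mult_mat)
  finally show ?thesis by (simp add: normalized_trace_def mult.commute)
qed

text \<open>The case A = B = I of the Markov formula; it identifies the factor c/2 as the trace of X
  itself.\<close>

lemma normalized_trace_of_scalar_ptrace:
  assumes X: "X \<in> carrier_mat (2 ^ (n + 1)) (2 ^ (n + 1))"
    and ptrace: "\<And>i j. i < 2 ^ n \<Longrightarrow> j < 2 ^ n \<Longrightarrow>
      (\<Sum>k<2. X $$ (2 * i + k, 2 * j + k)) = (if i = j then c else 0)"
  shows "normalized_trace (n + 1) X = c / 2"
proof -
  have "1\<^sub>m (2 ^ n) \<otimes>\<^sub>K 1\<^sub>m 2 = 1\<^sub>m (2 ^ (n + 1))" by (simp add: kronecker_one mult.commute)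
  then show ?thesis
    using normalized_trace_markov[OF one_carrier_mat one_carrier_mat X ptrace] X by simp
qed

section \<open>The matrices of the braid generators\<close>

lemma R_mat_carrier [simp]: "R_mat q \<in> carrier_mat 4 4"
  by (rule carrier_matI) (simp_all add: R_mat_def mat_of_rows_list_def)

text \<open>The middle block of R is q^-1 times a swap, an involution, and the outer entries are q.
  Inverting R therefore just inverts the parameter.\<close>

lemma R_mat_inverse: "q \<noteq> 0 \<Longrightarrow> R_mat q * R_mat (inverse q) = 1\<^sub>m 4"
  by (rule eq_matI)
    (auto simp: R_mat_def mat_of_rows_list_def scalar_prod_def numeral_eq_Suc less_Suc_eq)

lemma G_mat_dim:
  assumes "1 \<le> i" "i < n"
  shows "2 ^ (i - Suc 0) * (4 * 2 ^ (n - Suc i)) = (2 ^ n :: nat)"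
proof -
  have "n = (i - Suc 0) + (2 + (n - Suc i))" using assms by simp
  then have "(2 ^ n :: nat) = 2 ^ (i - Suc 0) * (2 ^ 2 * 2 ^ (n - Suc i))" by (metis power_add)
  then show ?thesis by simp
qed

lemma G_mat_carrier [simp]: "1 \<le> i \<Longrightarrow> i < n \<Longrightarrow> G_mat n q i \<in> carrier_mat (2 ^ n) (2 ^ n)"
  using kronecker_carrier[OF one_carrier_mat[of "2 ^ (i - 1)"]
      kronecker_carrier[OF R_mat_carrier[of q] one_carrier_mat[of "2 ^ (n - i - 1)"]]]
  by (simp add: G_mat_def G_mat_dim)

lemma G_mat_inverse:
  assumes "1 \<le> i" "i < n" "q \<noteq> 0"
  shows "G_mat n q i * G_mat n (inverse q) i = 1\<^sub>m (2 ^ n)"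
proof -
  let ?k = "2 ^ (i - 1) :: nat" and ?l = "2 ^ (n - i - 1) :: nat"
  have "G_mat n q i * G_mat n (inverse q) i =
      (1\<^sub>m ?k * 1\<^sub>m ?k) \<otimes>\<^sub>K ((R_mat q \<otimes>\<^sub>K 1\<^sub>m ?l) * (R_mat (inverse q) \<otimes>\<^sub>K 1\<^sub>m ?l))"
    unfolding G_mat_def
    by (rule kronecker_mult[OF one_carrier_mat kronecker_carrier[OF R_mat_carrier one_carrier_mat]
          one_carrier_mat kronecker_carrier[OF R_mat_carrier one_carrier_mat]])
  also have "(R_mat q \<otimes>\<^sub>K 1\<^sub>m ?l) * (R_mat (inverse q) \<otimes>\<^sub>K 1\<^sub>m ?l) =
      (R_mat q * R_mat (inverse q)) \<otimes>\<^sub>K (1\<^sub>m ?l * 1\<^sub>m ?l)"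
    by (rule kronecker_mult[OF R_mat_carrier one_carrier_mat R_mat_carrier one_carrier_mat])
  also have "(1\<^sub>m ?k * 1\<^sub>m ?k) \<otimes>\<^sub>K \<dots> = 1\<^sub>m (2 ^ n)"
    using assms by (simp add: R_mat_inverse kronecker_one G_mat_dim)
  finally show ?thesis .
qed

lemma mat_left_inverse_unique:
  assumes "A \<in> carrier_mat k k" "B \<in> carrier_mat k k" "C \<in> carrier_mat k k"
    and "(A :: complex mat) * B = 1\<^sub>m k" "C * A = 1\<^sub>m k"
  shows "C = B"
  using assoc_mult_mat[of C k k A k B k] assms by simp

lemma inv_G_mat:
  assumes "1 \<le> i" "i < n" "q \<noteq> 0"
  shows "inv\<^bsub>Mat_alg n\<^esub> (G_mat n q i) = G_mat n (inverse q) i"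
proof -
  have "G_mat n (inverse q) i * G_mat n q i = 1\<^sub>m (2 ^ n)"
    using G_mat_inverse[of i n "inverse q"] assms by simp
  then show ?thesis
    unfolding m_inv_def module_mat_simps
    using assms G_mat_inverse[of i n q] mat_left_inverse_unique[of "G_mat n q i" "2 ^ n" "G_mat n (inverse q) i"]
    by (intro the_equality) auto
qed

lemma G_mat_kronecker_one:
  assumes "1 \<le> i" "i < m" "m \<le> n"
  shows "G_mat n q i = G_mat m q i \<otimes>\<^sub>K 1\<^sub>m (2 ^ (n - m))"
proof -
  have "n - i - 1 = (m - i - 1) + (n - m)" using assms by simp
  then show ?thesis
    by (simp only: G_mat_def power_add kronecker_one[symmetric] kronecker_assoc)
qed

text \<open>The last generator is I tensor R, and tracing out the second factor of R leaves the
  diagonal sums q + 0 and 0 + q, with zeros off the diagonal.\<close>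

lemma ptrace_G_mat:
  assumes "n \<ge> 1" "i < 2 ^ n" "j < 2 ^ n"
  shows "(\<Sum>k<2. G_mat (n + 1) q n $$ (2 * i + k, 2 * j + k)) = (if i = j then q else 0)"
proof -
  have N: "2 ^ n = 2 ^ (n - 1) * (2 :: nat)" using assms(1) by (cases n) auto
  have G: "G_mat (n + 1) q n = 1\<^sub>m (2 ^ (n - 1)) \<otimes>\<^sub>K R_mat q"
    using kronecker_one_one[of "R_mat q"] by (simp add: G_mat_def)
  \<comment> \<open>The bit i mod 2 is the state of the n-th factor; together with k it gives the
    row of R.\<close>
  have ent: "G_mat (n + 1) q n $$ (2 * i + k, 2 * j + k) =
      (if i div 2 = j div 2 then R_mat q $$ (2 * (i mod 2) + k, 2 * (j mod 2) + k) else 0)"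
    if "k < 2" for k
  proof -
    have dm: "(2 * l + k) div 4 = l div 2" "(2 * l + k) mod 4 = 2 * (l mod 2) + k" for l
      using that div_mult2_eq[of "2 * l + k" 2 2] mod_mult2_eq[of "2 * l + k" 2 2] by simp_all
    have "2 * i + k < 2 ^ (n - 1) * 4" "2 * j + k < 2 ^ (n - 1) * 4"
      using assms that N by linarith+
    moreover have "i div 2 < 2 ^ (n - 1)" "j div 2 < 2 ^ (n - 1)" using assms N by auto
    ultimately show ?thesis
      unfolding G by (subst index_kronecker[OF one_carrier_mat R_mat_carrier]) (auto simp: dm)
  qed
  have "i mod 2 = 0 \<or> i mod 2 = 1" "j mod 2 = 0 \<or> j mod 2 = 1" by auto
  moreover have "i = j \<longleftrightarrow> i div 2 = j div 2 \<and> i mod 2 = j mod 2" by (metis div_mult_mod_eq)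
  moreover have "(\<Sum>k<2. G_mat (n + 1) q n $$ (2 * i + k, 2 * j + k)) =
      (if i div 2 = j div 2 then R_mat q $$ (2 * (i mod 2), 2 * (j mod 2)) +
        R_mat q $$ (2 * (i mod 2) + 1, 2 * (j mod 2) + 1) else 0)"
    using ent[of 0] ent[of 1] by (simp add: sum_lessThan_2)
  ultimately show ?thesis
    by (auto simp: R_mat_def mat_of_rows_list_def)
qed

lemma E_mat_carrier: "n \<ge> 1 \<Longrightarrow> q \<noteq> 0 \<Longrightarrow> E_mat (n + 1) q n \<in> carrier_mat (2 ^ (n + 1)) (2 ^ (n + 1))"
  using G_mat_carrier[of n "n + 1"] inv_G_mat[of n "n + 1" q]
  unfolding E_mat_def by (metis minus_carrier_mat smult_carrier_mat less_add_one)

text \<open>The identity contributes 2, and G and its inverse contribute q and q^-1, so the scalar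
  is 2 - (q - q^-1)/(q - q^-1) = 1. Hence E has trace 1/2, matching 1/x.\<close>

lemma ptrace_E_mat:
  assumes "n \<ge> 1" "i < 2 ^ n" "j < 2 ^ n" and q: "q \<noteq> 0" "q - inverse q \<noteq> 0"
  shows "(\<Sum>k<2. E_mat (n + 1) q n $$ (2 * i + k, 2 * j + k)) = (if i = j then 1 else 0)"
proof -
  define s where "s = 1 / (q - inverse q)"
  have G: "G_mat (n + 1) q n \<in> carrier_mat (2 ^ (n + 1)) (2 ^ (n + 1))"
    "G_mat (n + 1) (inverse q) n \<in> carrier_mat (2 ^ (n + 1)) (2 ^ (n + 1))"
    by (rule G_mat_carrier; use assms(1) in simp)+
  have "(\<Sum>k<2. E_mat (n + 1) q n $$ (2 * i + k, 2 * j + k)) =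
      (\<Sum>k<2. (if i = j then 1 else 0) - s * (G_mat (n + 1) q n $$ (2 * i + k, 2 * j + k) -
        G_mat (n + 1) (inverse q) n $$ (2 * i + k, 2 * j + k)))"
  proof (rule sum.cong[OF HOL.refl])
    fix k assume "k \<in> {..<2 :: nat}"
    then have "2 * i + k < 2 ^ (n + 1)" "2 * j + k < 2 ^ (n + 1)" using assms by auto
    then show "E_mat (n + 1) q n $$ (2 * i + k, 2 * j + k) =
        (if i = j then 1 else 0) - s * (G_mat (n + 1) q n $$ (2 * i + k, 2 * j + k) -
          G_mat (n + 1) (inverse q) n $$ (2 * i + k, 2 * j + k))"
      using G inv_G_mat[of n "n + 1" q] assms(1) q(1)
      by (simp add: E_mat_def s_def[symmetric] del: power_Suc)
  qed
  also have "\<dots> = 2 * (if i = j then 1 else 0) - s * ((if i = j then q else 0) - (if i = j then inverse q else 0))"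
    unfolding ptrace_G_mat[OF assms(1-3), symmetric]
    by (simp add: sum_subtractf sum_distrib_left[symmetric])
  finally show ?thesis using q by (simp add: s_def)
qed

section \<open>Size of the matrices in A_n\<close>

lemma braid_rep_carrier:
  assumes "q \<noteq> 0" "X \<in> carrier (braid_group n)"
  shows "braid_rep n q X \<in> carrier_mat (2 ^ n) (2 ^ n)"
proof -
  obtain u where u: "X = braid_class n u" "set u \<subseteq> letters n"
    using assms(2) by (auto simp: braid_group_def)
  then have "u \<in> X" by (auto simp: braid_class_def intro: braid_equiv.refl)
  \<comment> \<open>A class is nonempty and contains only words in \<open>letters n\<close>, so the
    chosen representative is a product of well-formed generator matrices.\<close>
  then have "(SOME w. w \<in> X) \<in> X" by (rule someI)
  then have w: "set (SOME w. w \<in> X) \<subseteq> letters n" using u by (auto simp: braid_class_def)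
  have "letter_mat n q l \<in> carrier_mat (2 ^ n) (2 ^ n)" if "l \<in> letters n" for l
    using that assms(1) by (auto simp: letters_def inv_G_mat)
  then have "word_mat n q w \<in> carrier_mat (2 ^ n) (2 ^ n)" if "set w \<subseteq> letters n" for w
    using that by (induction w) (auto simp: word_mat_def intro!: mult_carrier_mat[of _ _ "2 ^ n"])
  then show ?thesis using w by (simp add: braid_rep_def)
qed

lemma A_alg_carrier: "q \<noteq> 0 \<Longrightarrow> carrier (A_alg n q) \<subseteq> carrier_mat (2 ^ n) (2 ^ n)"
  using LinearCombinations.module.span_is_subset2[OF vectorspace.axioms(1)[OF matrix_vs],
      of "braid_rep n q ` carrier (braid_group n)" "2 ^ n" "2 ^ n"] braid_rep_carrier[of q _ n]
  by (auto simp: A_alg_def module_mat_simps)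

lemma A_alg_simps:
  "mult (A_alg n q) = (*)" "add (A_alg n q) = (+)" "one (A_alg n q) = 1\<^sub>m (2 ^ n)"
  "smult (A_alg n q) = (\<cdot>\<^sub>m)"
  by (simp_all add: A_alg_def module_mat_simps)

section \<open>Representations of the BMW algebra on tensor powers\<close>

context
  fixes q :: complex and n :: nat and \<phi> :: "free_elem set \<Rightarrow> complex mat"
begin

text \<open>The homomorphism pulled back to the free algebra, where induction on letters is
  available.\<close>

definition rep :: "free_elem \<Rightarrow> complex mat" where
  "rep a = \<phi> (bmw_elem q q n a)"

context
  assumes q: "q \<noteq> 0"
    and hom: "algebra_hom (bmw q q n) (A_alg n q) \<phi>"
    and gens: "\<And>i. 1 \<le> i \<Longrightarrow> i < n \<Longrightarrow> \<phi> (bmw_elem q q n (gen i)) = G_mat n q i"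
begin

lemma rep_carrier [simp]: "a \<in> free_carrier n \<Longrightarrow> rep a \<in> carrier_mat (2 ^ n) (2 ^ n)"
  using hom A_alg_carrier[OF q, of n]
  by (auto simp: algebra_hom_def Ring.ring_hom_def rep_def carrier_bmw)

lemma rep_mult: "a \<in> free_carrier n \<Longrightarrow> b \<in> free_carrier n \<Longrightarrow> rep (a * b) = rep a * rep b"
  using ring_hom_mult[of \<phi> "bmw q q n" "A_alg n q" "bmw_elem q q n a" "bmw_elem q q n b"] hom
  by (simp add: algebra_hom_def rep_def carrier_bmw A_alg_simps mult_bmw)

lemma rep_add: "a \<in> free_carrier n \<Longrightarrow> b \<in> free_carrier n \<Longrightarrow> rep (a + b) = rep a + rep b"
  using ring_hom_add[of \<phi> "bmw q q n" "A_alg n q" "bmw_elem q q n a" "bmw_elem q q n b"] hom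
  by (simp add: algebra_hom_def rep_def carrier_bmw A_alg_simps add_bmw)

lemma rep_smult: "a \<in> free_carrier n \<Longrightarrow> rep (scalar c * a) = c \<cdot>\<^sub>m rep a"
  using hom by (simp add: algebra_hom_def rep_def carrier_bmw A_alg_simps smult_bmw[symmetric])

lemma rep_one: "rep 1 = 1\<^sub>m (2 ^ n)"
  using hom one_bmw[of q q n]
  by (simp add: algebra_hom_def Ring.ring_hom_def rep_def A_alg_simps)

lemma rep_scalar: "rep (scalar c) = c \<cdot>\<^sub>m 1\<^sub>m (2 ^ n)"
  using rep_smult[of 1 c] rep_one by simp

lemma rep_gen: "1 \<le> i \<Longrightarrow> i < n \<Longrightarrow> rep (gen i) = G_mat n q i"
  by (simp add: rep_def gens)

text \<open>Only the images of the g_i are prescribed. The relator g_i^-1 g_i - 1 makes the image of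
  g_i^-1 a left inverse of \<open>G_mat n q i\<close>, and that inverse is unique.\<close>

lemma rep_gen_inv:
  assumes i: "1 \<le> i" "i < n"
  shows "rep (gen_inv i) = G_mat n (inverse q) i"
proof (rule mat_left_inverse_unique)
  have "bmw_elem q q n (gen_inv i * gen i) = bmw_elem q q n 1"
    using cong_left_inverse[OF i, of q q] i by (simp add: bmw_elem_eq_iff bmw_cong_def)
  then have "rep (gen_inv i * gen i) = rep 1" by (simp add: rep_def)
  then show "rep (gen_inv i) * G_mat n q i = 1\<^sub>m (2 ^ n)"
    using i by (simp add: rep_mult rep_gen rep_one)
qed (use i q in \<open>auto simp: G_mat_inverse\<close>)

text \<open>Generators of index below m act trivially on the last n - m factors. As the homomorphism
  exists at level n only, the left factor is built up letter by letter.\<close>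

lemma rep_eq_kronecker_one:
  assumes "a \<in> free_carrier m" and "m \<le> n"
  shows "\<exists>A \<in> carrier_mat (2 ^ m) (2 ^ m). rep a = A \<otimes>\<^sub>K 1\<^sub>m (2 ^ (n - m))"
  using assms(1)
proof (induction rule: free_carrier_induct)
  case (scalar c)
  have "(2 :: nat) ^ m * 2 ^ (n - m) = 2 ^ n" using assms(2) by (simp add: power_add[symmetric])
  then have "rep (scalar c) = (c \<cdot>\<^sub>m 1\<^sub>m (2 ^ m)) \<otimes>\<^sub>K 1\<^sub>m (2 ^ (n - m))"
    by (simp add: rep_scalar kronecker_smult_left kronecker_one)
  then show ?case by (intro bexI[of _ "c \<cdot>\<^sub>m 1\<^sub>m (2 ^ m)"]) auto
next
  case (add a b)
  then obtain A B where "A \<in> carrier_mat (2 ^ m) (2 ^ m)" "rep a = A \<otimes>\<^sub>K 1\<^sub>m (2 ^ (n - m))"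
    "B \<in> carrier_mat (2 ^ m) (2 ^ m)" "rep b = B \<otimes>\<^sub>K 1\<^sub>m (2 ^ (n - m))" by auto
  then show ?case
    using add free_carrier_mono[OF assms(2)]
    by (intro bexI[of _ "A + B"]) (auto simp: rep_add kronecker_add_left)
next
  case (gen a i)
  then obtain A where A: "A \<in> carrier_mat (2 ^ m) (2 ^ m)" "rep a = A \<otimes>\<^sub>K 1\<^sub>m (2 ^ (n - m))" by auto
  have "rep (a * gen i) = (A \<otimes>\<^sub>K 1\<^sub>m (2 ^ (n - m))) * (G_mat m q i \<otimes>\<^sub>K 1\<^sub>m (2 ^ (n - m)))"
    using gen A assms(2) free_carrier_mono[OF assms(2)] G_mat_kronecker_one[of i m n q]
    by (simp add: rep_mult rep_gen)
  also have "\<dots> = (A * G_mat m q i) \<otimes>\<^sub>K 1\<^sub>m (2 ^ (n - m))"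
    using kronecker_mult[OF A(1) one_carrier_mat G_mat_carrier[OF \<open>1 \<le> i\<close> \<open>i < m\<close>] one_carrier_mat] by simp
  finally show ?case using gen A by (intro bexI[of _ "A * G_mat m q i"]) auto
next
  case (gen_inv a i)
  then obtain A where A: "A \<in> carrier_mat (2 ^ m) (2 ^ m)" "rep a = A \<otimes>\<^sub>K 1\<^sub>m (2 ^ (n - m))" by auto
  have "rep (a * gen_inv i) = (A \<otimes>\<^sub>K 1\<^sub>m (2 ^ (n - m))) * (G_mat m (inverse q) i \<otimes>\<^sub>K 1\<^sub>m (2 ^ (n - m)))"
    using gen_inv A assms(2) free_carrier_mono[OF assms(2)] G_mat_kronecker_one[of i m n "inverse q"]
    by (simp add: rep_mult rep_gen_inv)
  also have "\<dots> = (A * G_mat m (inverse q) i) \<otimes>\<^sub>K 1\<^sub>m (2 ^ (n - m))"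
    using kronecker_mult[OF A(1) one_carrier_mat G_mat_carrier[OF \<open>1 \<le> i\<close> \<open>i < m\<close>] one_carrier_mat] by simp
  finally show ?case using gen_inv A by (intro bexI[of _ "A * G_mat m (inverse q) i"]) auto
qed

text \<open>Everything acts trivially beyond factor m + 1, so the trace is computed on m + 1
  factors, where c acts as the last generator. The parameter p stands for q or q^-1, that is, for
  g_m or its inverse.\<close>

lemma normalized_trace_rep_markov:
  assumes m: "1 \<le> m" "m < n" and ab: "a \<in> free_carrier m" "b \<in> free_carrier m"
    and c: "c \<in> free_carrier n" "rep c = G_mat n p m"
  shows "normalized_trace n (rep (a * c * b)) = p / 2 * normalized_trace n (rep (a * b))"
proof -
  let ?I = "1\<^sub>m (2 ^ (n - (m + 1))) :: complex mat" and ?J = "1\<^sub>m (2 ^ (n - m)) :: complex mat"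
  obtain A B where A: "A \<in> carrier_mat (2 ^ m) (2 ^ m)" "rep a = A \<otimes>\<^sub>K ?J"
    and B: "B \<in> carrier_mat (2 ^ m) (2 ^ m)" "rep b = B \<otimes>\<^sub>K ?J"
    using rep_eq_kronecker_one[OF ab(1)] rep_eq_kronecker_one[OF ab(2)] m by auto
  have F: "a \<in> free_carrier n" "b \<in> free_carrier n" using ab m free_carrier_mono[of m n] by auto
  \<comment> \<open>Factor m + 1, on which c acts but a and b do not, is split off from the idle
    ones.\<close>
  have "n - m = Suc (n - (m + 1))" using m by simp
  then have J: "?J = 1\<^sub>m 2 \<otimes>\<^sub>K ?I" by (simp only: kronecker_one power_Suc)
  have G: "G_mat (m + 1) p m \<in> carrier_mat (2 ^ (m + 1)) (2 ^ (m + 1))"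
    by (rule G_mat_carrier) (use m in auto)
  have K: "C \<otimes>\<^sub>K 1\<^sub>m 2 \<in> carrier_mat (2 ^ (m + 1)) (2 ^ (m + 1))" if "C \<in> carrier_mat (2 ^ m) (2 ^ m)" for C
    using kronecker_carrier[OF that one_carrier_mat[of 2]] by (simp add: mult.commute)
  have "rep (a * c * b) = ((A \<otimes>\<^sub>K 1\<^sub>m 2) \<otimes>\<^sub>K ?I) * (G_mat (m + 1) p m \<otimes>\<^sub>K ?I) * ((B \<otimes>\<^sub>K 1\<^sub>m 2) \<otimes>\<^sub>K ?I)"
    using F c m A(2) B(2) G_mat_kronecker_one[of m "m + 1" n p]
    by (simp add: rep_mult J kronecker_assoc)
  also have "\<dots> = ((A \<otimes>\<^sub>K 1\<^sub>m 2) * G_mat (m + 1) p m * (B \<otimes>\<^sub>K 1\<^sub>m 2)) \<otimes>\<^sub>K ?I"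
    by (subst kronecker_mult[OF K[OF A(1)] one_carrier_mat G one_carrier_mat],
        subst kronecker_mult[OF mult_carrier_mat[OF K[OF A(1)] G] _ K[OF B(1)] one_carrier_mat]) auto
  finally have "normalized_trace n (rep (a * c * b)) =
      normalized_trace (m + 1) ((A \<otimes>\<^sub>K 1\<^sub>m 2) * G_mat (m + 1) p m * (B \<otimes>\<^sub>K 1\<^sub>m 2))"
    using normalized_trace_kronecker_one[OF mult_carrier_mat[OF mult_carrier_mat[OF K[OF A(1)] G] K[OF B(1)]],
        of "n - (m + 1)"] m by simp
  also have "\<dots> = p / 2 * normalized_trace m (A * B)"
    by (rule normalized_trace_markov[OF A(1) B(1) G ptrace_G_mat[OF m(1)]])
  also have "rep (a * b) = (A * B) \<otimes>\<^sub>K ?J"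
    using F A B kronecker_mult[OF A(1) one_carrier_mat B(1) one_carrier_mat] by (simp add: rep_mult)
  then have "normalized_trace m (A * B) = normalized_trace n (rep (a * b))"
    using normalized_trace_kronecker_one[OF mult_carrier_mat[OF A(1) B(1)], of "n - m"] m by simp
  finally show ?thesis .
qed

lemma bmw_trace_eq_normalized_trace:
  assumes tr: "is_bmw_trace q q tr" and q2: "q - inverse q \<noteq> 0" and a: "a \<in> free_carrier n"
  shows "tr (bmw_incl q q n (bmw_elem q q n a)) = normalized_trace n (rep a)"
proof -
  define T where "T a = tr (bmw_incl q q n (bmw_elem q q n a))" for a
  define S where "S a = normalized_trace n (rep a)" for a
  have x: "2 = 1 + (q - inverse q) / (q - inverse q)" using q2 by simp
  note T = bmw_trace_markov[OF tr q2 x, where n = n, folded T_def]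
  have T_scalar: "T (scalar c) = c" for c using T(2)[of 1 c] T(3) by simp
  have S_scalar: "S (scalar c) = c" for c
    by (simp add: S_def rep_scalar normalized_trace_smult)
  have "T a - S a = 0"
  proof (rule markov_functional_vanishes[OF q2 q, where D = "\<lambda>a. T a - S a", OF _ _ _ _ a])
    fix a b assume "a \<in> free_carrier n" "b \<in> free_carrier n"
    then show "T (a + b) - S (a + b) = T a - S a + (T b - S b)"
      by (simp add: T(1) S_def rep_add normalized_trace_add)
  next
    fix a assume a: "a \<in> bmw_ideal n q q"
    then have "bmw_elem q q n a = bmw_elem q q n (scalar 0)"
      using bmw_ideal_carrier[OF a] by (simp add: bmw_elem_eq_iff)
    then show "T a - S a = 0" using T(4)[OF a] S_scalar[of 0] by (simp add: S_def rep_def)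
  next
    fix c show "T (scalar c) - S (scalar c) = 0" by (simp add: T_scalar S_scalar)
  next
    fix m a b c
    assume m: "1 \<le> m" "m < n" and ab: "a \<in> free_carrier m" "b \<in> free_carrier m"
      and c: "c \<in> {gen m, gen_inv m}" and eq: "T (a * b) - S (a * b) = 0"
    consider "c = gen m" | "c = gen_inv m" using c by auto
    then show "T (a * c * b) - S (a * c * b) = 0"
    proof cases
      case 1
      have "S (a * c * b) = q / 2 * S (a * b)"
        unfolding S_def 1 by (rule normalized_trace_rep_markov[OF m ab]) (use m in \<open>simp_all add: rep_gen\<close>)
      then show ?thesis using T(5)[OF m ab] eq by (simp only: 1 right_minus_eq)
    next
      case 2
      have "S (a * c * b) = inverse q / 2 * S (a * b)"
        unfolding S_def 2 by (rule normalized_trace_rep_markov[OF m ab]) (use m in \<open>simp_all add: rep_gen_inv\<close>)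
      \<comment> \<open>With x = 2, the factor derived from the trace axioms for g_m^-1 agrees with
        half the partial trace q^-1 of R^-1.\<close>
      moreover have "q / 2 - (q - inverse q) * (1 - 1 / 2) = inverse q / 2" by (simp add: field_simps)
      ultimately show ?thesis using T(6)[OF m ab] eq by (simp only: 2 right_minus_eq)
    qed
  qed
  then show ?thesis by (simp add: T_def S_def)
qed

end

end

theorem mainTheorem2:
  fixes q :: complex and n :: nat
  assumes root_of_unity: "\<exists>k>0. q ^ k = 1"
    and q4: "q ^ 4 \<noteq> 1"
    and n: "n \<ge> 2"
  shows
    "(\<forall>A \<in> carrier (A_alg n q). \<forall>B \<in> carrier (A_alg n q).
      \<forall>\<chi> \<in> {E_mat (n+1) q n, G_mat (n+1) q n}.
        normalized_trace (n+1) ((A \<otimes>\<^sub>K 1\<^sub>m 2) * \<chi> * (B \<otimes>\<^sub>K 1\<^sub>m 2)) =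
        normalized_trace (n+1) \<chi> * normalized_trace n (A * B)) \<and>
     (\<forall>\<phi> tr.
        algebra_hom (bmw q q n) (A_alg n q) \<phi> \<longrightarrow>
        (\<forall>i. 1 \<le> i \<and> i \<le> n - 1 \<longrightarrow> \<phi> (bmw_elem q q n (gen i)) = G_mat n q i) \<longrightarrow>
        is_bmw_trace q q tr \<longrightarrow>
        (\<forall>a \<in> carrier (bmw q q n). tr (bmw_incl q q n a) = normalized_trace n (\<phi> a)))"
proof -
  have q: "q \<noteq> 0" using root_of_unity by (auto simp: power_0_left)
  \<comment> \<open>Here q^4 \<noteq> 1 enters: it excludes q = 1 and q = -1, where the denominator
    in e_i vanishes.\<close>
  have q2: "q - inverse q \<noteq> 0"
  proof
    assume "q - inverse q = 0"
    then have "q * q = 1" using q by (simp add: field_simps)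
    moreover have "q ^ 4 = (q * q) * (q * q)" by (simp add: power4_eq_xxxx)
    ultimately show False using q4 by simp
  qed
  have n1: "n \<ge> 1" using n by simp
  have G: "G_mat (n + 1) q n \<in> carrier_mat (2 ^ (n + 1)) (2 ^ (n + 1))"
    by (rule G_mat_carrier) (use n in auto)
  note E = E_mat_carrier[OF n1 q]
  show ?thesis
  proof (intro conjI ballI allI impI)
    fix A B \<chi>
    assume AB: "A \<in> carrier (A_alg n q)" "B \<in> carrier (A_alg n q)"
      and \<chi>: "\<chi> \<in> {E_mat (n + 1) q n, G_mat (n + 1) q n}"
    then have A: "A \<in> carrier_mat (2 ^ n) (2 ^ n)" and B: "B \<in> carrier_mat (2 ^ n) (2 ^ n)"
      using A_alg_carrier[OF q, of n] by auto
    note ptG = ptrace_G_mat[OF n1, of _ _ q]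
    note ptE = ptrace_E_mat[OF n1 _ _ q q2]
    \<comment> \<open>For each \<chi> both sides carry the same factor c/2, where c is the scalar
      partial trace: c = 1 for E and c = q for G.\<close>
    from \<chi> show "normalized_trace (n + 1) ((A \<otimes>\<^sub>K 1\<^sub>m 2) * \<chi> * (B \<otimes>\<^sub>K 1\<^sub>m 2)) =
        normalized_trace (n + 1) \<chi> * normalized_trace n (A * B)"
      using normalized_trace_markov[OF A B E ptE] normalized_trace_of_scalar_ptrace[OF E ptE]
        normalized_trace_markov[OF A B G ptG] normalized_trace_of_scalar_ptrace[OF G ptG]
      by (elim insertE emptyE) (simp_all only:)
  next
    fix \<phi> tr a
    assume hom: "algebra_hom (bmw q q n) (A_alg n q) \<phi>"
      and gens: "\<forall>i. 1 \<le> i \<and> i \<le> n - 1 \<longrightarrow> \<phi> (bmw_elem q q n (gen i)) = G_mat n q i"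
      and tr: "is_bmw_trace q q tr" and "a \<in> carrier (bmw q q n)"
    then obtain b where b: "a = bmw_elem q q n b" "b \<in> free_carrier n" by (auto simp: carrier_bmw)
    have "\<phi> (bmw_elem q q n (gen i)) = G_mat n q i" if "1 \<le> i" "i < n" for i
      using gens that by auto
    from bmw_trace_eq_normalized_trace[OF q hom this tr q2 b(2)]
    show "tr (bmw_incl q q n a) = normalized_trace n (\<phi> a)"
      using b(1) by (simp add: rep_def)
  qed
qed

end
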